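(* Consider the two-queue exhaustive polling system with partial information, where policy $p\in[0,1]$ means that each arriving customer joins the busy queue with probability $p$ and the idle queue with probability $1-p$. A policy is socially optimal if it minimizes the steady-state expected cost $C(p)$ of a customer over $p\in[0,1]$. (i) If $c>d$, the socially optimal policy is for everyone to join the idle queue ($p=0$). (ii) If $c=d$, all policies $p\in[0,1]$ are socially optimal. (iii) If $c<d$, the socially optimal policy is for everyone to join the busy queue ($p=1$).
   Context: Polling model: customers arrive according to a Poisson process with rate $\lambda>0$ at a system with two queues. Service times are independent and exponentially distributed with rate $\mu$ in each queue, and $\rho=\lambda/\mu<1$. A single server serves the two queues cyclically with exhaustive service: it serves a queue until that queue is empty and then moves to the other queue. Switch-over times are zero, so the server is never idle while customers are present. Within a queue, service is in order of arrival. A customer pays cost at rate $c$ per unit time while she is in a queue that is being served (including her own service), and at rate $d$ per unit time while she is in a queue that is not being served; here $c>0$, $d\ge 0$. Partial information: customers know at which queue the server is, but not the queue lengths. The queue where the server is located is called the busy queue, the other one the idle queue. If both queues are empty after a service completion, the server stays at the queue it served last, so busy and idle queue are well defined at all times (a customer joining the idle queue of an empty system is served immediately, the server switching in zero time). A policy is a number $p\in[0,1]$: each customer independently joins the busy queue (as defined at her arrival epoch) with probability $p$ and the idle queue with probability $1-p$. Let $C_B(p)$ and $C_I(p)$ be the expected total cost of a customer who arrives in steady state (under the policy $p$ followed by all other customers) and joins the busy queue, respectively the idle queue. The expected cost of a customer in steady state is $C(p)=p\,C_B(p)+(1-p)\,C_I(p)$. *)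

theory Defs
  imports "HOL-Probability.Probability"
begin

text \<open>
  A state is the pair (busy queue, idle queue); each queue lists its customers in order of arrival,
  head in service or next to be served. The two queues have identical characteristics, so the
  physical location of the server is not recorded. The type of customers is left open: \<^typ>\<open>unit\<close>
  when only the queue lengths matter, \<open>customer\<close> below when one customer is followed.
\<close>

type_synonym 'c state = "'c list \<times> 'c list"

text \<open>
  Exhaustive service with zero switch-over times: the server leaves its queue exactly when that
  queue is empty and the other one is not, so the two queues exchange roles. If both are empty,
  the state (and hence which queue counts as busy) does not change.
\<close>

fun settle :: "'c state \<Rightarrow> 'c state" where
  "settle (xs, ys) = (if xs = [] then (ys, []) else (xs, ys))"

fun join_busy :: "'c \<Rightarrow> 'c state \<Rightarrow> 'c state" where
  "join_busy z (xs, ys) = settle (xs @ [z], ys)"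

fun join_idle :: "'c \<Rightarrow> 'c state \<Rightarrow> 'c state" where
  "join_idle z (xs, ys) = settle (xs, ys @ [z])"

fun complete_service :: "'c state \<Rightarrow> 'c state" where
  "complete_service (xs, ys) = settle (tl xs, ys)"

text \<open>
  Stationary distributions of the continuous-time Markov chain of queue lengths (global balance:
  outflow = inflow in every state). States with an empty busy queue and a nonempty idle queue
  have no inflow and positive outflow, so they get probability 0.
\<close>

definition stationary :: "real \<Rightarrow> real \<Rightarrow> real \<Rightarrow> unit state pmf \<Rightarrow> bool" where
  "stationary lam mu p \<pi> \<longleftrightarrow>
     (\<forall>s. (lam + (if fst s \<noteq> [] then mu else 0)) * pmf \<pi> s =
            lam * p * measure_pmf.prob \<pi> {s'. join_busy () s' = s}
          + lam * (1 - p) * measure_pmf.prob \<pi> {s'. join_idle () s' = s}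
          + mu * measure_pmf.prob \<pi> {s'. fst s' \<noteq> [] \<and> complete_service s' = s})"

definition steady_state :: "real \<Rightarrow> real \<Rightarrow> real \<Rightarrow> unit state pmf" where
  "steady_state lam mu p = (THE \<pi>. stationary lam mu p \<pi>)"

datatype customer = Other | Tagged

text \<open>
  Sample paths by competing exponential clocks. The \<open>n\<close>-th component \<open>(a, s, b)\<close> of the driving
  sequence holds the time \<open>a\<close> from the \<open>n\<close>-th event to the next arrival, the time \<open>s\<close> to the next
  service completion, and the choice \<open>b\<close> of that arrival (\<open>True\<close>: the busy queue). By lack of memory
  both clocks may be restarted after every event. In an empty system the service clock is a dummy,
  as \<^const>\<open>complete_service\<close> leaves that state unchanged.
\<close>

definition clocks :: "real \<Rightarrow> real \<Rightarrow> real \<Rightarrow> (real \<times> real \<times> bool) measure" where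
  "clocks lam mu p =
     density lborel (exponential_density lam) \<Otimes>\<^sub>M
     (density lborel (exponential_density mu) \<Otimes>\<^sub>M measure_pmf (bernoulli_pmf p))"

fun next_state :: "real \<times> real \<times> bool \<Rightarrow> customer state \<Rightarrow> customer state" where
  "next_state (a, s, b) x =
     (if s < a then complete_service x
      else if b then join_busy Other x else join_idle Other x)"

fun holding_time :: "real \<times> real \<times> bool \<Rightarrow> real" where
  "holding_time (a, s, b) = min a s"

primrec state_after ::
    "customer state \<Rightarrow> (real \<times> real \<times> bool) stream \<Rightarrow> nat \<Rightarrow> customer state" where
  "state_after x \<omega> 0 = x"
| "state_after x \<omega> (Suc n) = next_state (\<omega> !! n) (state_after x \<omega> n)"

definition cost_rate :: "real \<Rightarrow> real \<Rightarrow> customer state \<Rightarrow> real" where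
  "cost_rate c d x =
     (if Tagged \<in> set (fst x) then c else if Tagged \<in> set (snd x) then d else 0)"

definition expected_cost ::
    "real \<Rightarrow> real \<Rightarrow> real \<Rightarrow> real \<Rightarrow> real \<Rightarrow> customer state \<Rightarrow> ennreal" where
  "expected_cost lam mu c d p x =
     (\<integral>\<^sup>+\<omega>. (\<Sum>n. ennreal (cost_rate c d (state_after x \<omega> n) * holding_time (\<omega> !! n)))
        \<partial>stream_space (clocks lam mu p))"

definition others :: "unit state \<Rightarrow> customer state" where
  "others = map_prod (map (\<lambda>_. Other)) (map (\<lambda>_. Other))"

text \<open>Poisson arrivals see time averages: an arrival in steady state finds the system in a state
  distributed according to the stationary distribution.\<close>

definition cost_busy :: "real \<Rightarrow> real \<Rightarrow> real \<Rightarrow> real \<Rightarrow> real \<Rightarrow> ennreal" where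
  "cost_busy lam mu c d p =
     (\<integral>\<^sup>+s. expected_cost lam mu c d p (join_busy Tagged (others s))
        \<partial>measure_pmf (steady_state lam mu p))"

definition cost_idle :: "real \<Rightarrow> real \<Rightarrow> real \<Rightarrow> real \<Rightarrow> real \<Rightarrow> ennreal" where
  "cost_idle lam mu c d p =
     (\<integral>\<^sup>+s. expected_cost lam mu c d p (join_idle Tagged (others s))
        \<partial>measure_pmf (steady_state lam mu p))"

definition cost :: "real \<Rightarrow> real \<Rightarrow> real \<Rightarrow> real \<Rightarrow> real \<Rightarrow> ennreal" where
  "cost lam mu c d p =
     ennreal p * cost_busy lam mu c d p + ennreal (1 - p) * cost_idle lam mu c d p"

definition socially_optimal :: "real \<Rightarrow> real \<Rightarrow> real \<Rightarrow> real \<Rightarrow> real \<Rightarrow> bool" where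
  "socially_optimal lam mu c d p \<longleftrightarrow>
     p \<in> {0..1} \<and> (\<forall>q\<in>{0..1}. cost lam mu c d p \<le> cost lam mu c d q)"

end

theory Submission
  imports Defs
begin

text \<open>
  Uniformisation replaces the two exponential clocks by a discrete chain. The total number of
  customers is an M/M/1 queue for every routing policy, so its mean \<open>L\<close> does not depend on \<open>p\<close>. Using
  the product of the two queue lengths as a test function in the balance equations gives
  \<open>(\<mu> - \<lambda> p) E[idle] = \<lambda> (1 - p) E[busy]\<close>, and the two relations determine both means.
  A tagged customer with \<open>k\<close> customers ahead in her queue pays \<open>c (k + 1) / \<mu>\<close> while it is being
  served, and beforehand \<open>d i / (\<mu> - \<lambda> p)\<close> if she waits in the idle queue for \<open>i\<close> busy customers.
  Averaging over the steady state gives \<open>\<lambda> C(p) = c L + (d - c) E[idle]\<close>, where \<open>E[idle]\<close> is strictly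
  decreasing in \<open>p\<close>.
\<close>

section \<open>Invariant laws of countable Markov chains\<close>

text \<open>\<open>steady_state\<close> is a definite description over the balance equations, so
  existence and uniqueness of the stationary law come before any moment. The total event rate
  \<open>lam + mu\<close> is the same in every state because the service clock also runs, as a
  dummy, in the empty system; hence the jump chain has the same stationary law and every holding
  time has mean \<open>1 / (lam + mu)\<close>. Infinite values are the other obstacle, since all
  expectations live in \<open>ennreal\<close>. The product of the queue lengths yields a relation
  only after its own mean cancels, which takes a finite second moment of the total; and a solution
  of the one-step cost equation is the expected cost only if its iterated remainder vanishes. The
  closing formula is Little's law: \<lambda> times the cost per customer is the mean cost rate,
  \<open>c\<close> per busy and \<open>d\<close> per idle customer. The policy only divides a fixed
  mean total between the two prices, so the sign of \<open>c - d\<close> decides.\<close>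

lemma nn_integral_count_space_eq_imp_eq:
  fixes f g :: "'s \<Rightarrow> ennreal"
  assumes le: "\<And>s. f s \<le> g s"
    and eq: "(\<integral>\<^sup>+s. f s \<partial>count_space UNIV) = (\<integral>\<^sup>+s. g s \<partial>count_space UNIV)"
    and fin: "(\<integral>\<^sup>+s. g s \<partial>count_space UNIV) < \<infinity>"
  shows "f s = g s"
proof -
  have "(\<integral>\<^sup>+s. g s - f s \<partial>count_space UNIV) = 0"
    using le eq fin by (subst nn_integral_diff) (auto simp: less_top[symmetric])
  hence "AE s in count_space UNIV. g s - f s = 0"
    by (subst (asm) nn_integral_0_iff_AE) auto
  hence "g s - f s = 0" by (auto simp: AE_count_space)
  thus ?thesis using le[of s]
    by (metis antisym diff_eq_0_iff_ennreal ennreal_minus_eq_0)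
qed

lemma nn_integral_count_space_insert_point:
  fixes f :: "'s \<Rightarrow> ennreal"
  shows "(\<integral>\<^sup>+s. f s \<partial>count_space UNIV) = f a + (\<integral>\<^sup>+s. (if s = a then 0 else f s) \<partial>count_space UNIV)"
proof -
  have "(\<integral>\<^sup>+s. f s \<partial>count_space UNIV)
      = (\<integral>\<^sup>+s. f s * indicator {a} s + (if s = a then 0 else f s) \<partial>count_space UNIV)"
    by (intro nn_integral_cong) (auto simp: indicator_def)
  also have "\<dots> = (\<integral>\<^sup>+s. f s * indicator {a} s \<partial>count_space UNIV) +
     (\<integral>\<^sup>+s. (if s = a then 0 else f s) \<partial>count_space UNIV)"
    by (rule nn_integral_add) auto
  also have "(\<integral>\<^sup>+s. f s * indicator {a} s \<partial>count_space UNIV) = f a"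
    by (subst nn_integral_indicator_singleton) auto
  finally show ?thesis .
qed

text \<open>Acts on \<open>ennreal\<close> densities rather than on laws, since the pointwise
  minimum of two laws and the occupation measure of an excursion are not normalised.\<close>

definition push :: "('s \<Rightarrow> 's pmf) \<Rightarrow> ('s \<Rightarrow> ennreal) \<Rightarrow> 's \<Rightarrow> ennreal" where
  "push K u t = (\<integral>\<^sup>+s. u s * pmf (K s) t \<partial>count_space UNIV)"

lemma push_mono: "(\<And>s. u s \<le> v s) \<Longrightarrow> push K u t \<le> push K v t"
  unfolding push_def by (intro nn_integral_mono mult_right_mono) auto

lemma nn_integral_push:
  fixes K :: "'s::countable \<Rightarrow> 's pmf"
  shows "(\<integral>\<^sup>+t. push K u t * f t \<partial>count_space UNIV)
       = (\<integral>\<^sup>+s. u s * (\<integral>\<^sup>+t. f t \<partial>K s) \<partial>count_space UNIV)"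
proof -
  have sf: "sigma_finite_measure (count_space (UNIV::'s set))"
    by (rule sigma_finite_measure_count_space)
  interpret pair_sigma_finite "count_space (UNIV::'s set)" "count_space (UNIV::'s set)"
    by (simp add: pair_sigma_finite_def sf)
  have "(\<integral>\<^sup>+t. push K u t * f t \<partial>count_space UNIV)
      = (\<integral>\<^sup>+t. \<integral>\<^sup>+s. u s * pmf (K s) t * f t \<partial>count_space UNIV \<partial>count_space UNIV)"
    unfolding push_def by (subst nn_integral_multc[symmetric]) auto
  also have "\<dots> = (\<integral>\<^sup>+s. \<integral>\<^sup>+t. u s * pmf (K s) t * f t \<partial>count_space UNIV \<partial>count_space UNIV)"
    by (rule Fubini') (auto simp: pair_measure_countable)
  also have "\<dots> = (\<integral>\<^sup>+s. u s * (\<integral>\<^sup>+t. f t \<partial>K s) \<partial>count_space UNIV)"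
    by (simp add: nn_integral_measure_pmf nn_integral_cmult[symmetric] mult.assoc)
  finally show ?thesis .
qed

lemma nn_integral_push_one:
  fixes K :: "'s::countable \<Rightarrow> 's pmf"
  shows "(\<integral>\<^sup>+t. push K u t \<partial>count_space UNIV) = (\<integral>\<^sup>+s. u s \<partial>count_space UNIV)"
  using nn_integral_push[of K u "\<lambda>_. 1"] by simp

lemma bind_pmf_eq_self_iff_push:
  "bind_pmf M K = M \<longleftrightarrow> (\<forall>t. push K (\<lambda>s. ennreal (pmf M s)) t = ennreal (pmf M t))"
proof -
  have "push K (\<lambda>s. ennreal (pmf M s)) t = ennreal (pmf (bind_pmf M K) t)" for t
    by (simp add: push_def ennreal_pmf_bind nn_integral_measure_pmf)
  thus ?thesis by (auto simp: pmf_eq_iff)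
qed

lemma pmf_le_imp_eq:
  assumes "\<And>s. pmf M s \<le> pmf N s" shows "M = N"
proof (rule pmf_eqI)
  fix s
  have "ennreal (pmf M s) = ennreal (pmf N s)"
    by (rule nn_integral_count_space_eq_imp_eq[where f = "\<lambda>s. ennreal (pmf M s)"])
       (use assms in \<open>auto simp: nn_integral_pmf ennreal_leI\<close>)
  thus "pmf M s = pmf N s" by simp
qed

text \<open>The pointwise minimum of two invariant laws is again invariant, so the set where one of them
  attains the minimum is closed under predecessors of positive probability.\<close>

lemma invariant_pmf_unique:
  fixes K :: "'s::countable \<Rightarrow> 's pmf"
  assumes M: "bind_pmf M K = M" and N: "bind_pmf N K = N"
    and reach: "\<And>s. (s, a) \<in> {(s, t). t \<in> set_pmf (K s)}\<^sup>*"
  shows "M = N"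
proof -
  define m where "m s = min (ennreal (pmf M s)) (ennreal (pmf N s))" for s
  have fin: "(\<integral>\<^sup>+s. m s \<partial>count_space UNIV) < \<infinity>"
  proof -
    have "(\<integral>\<^sup>+s. m s \<partial>count_space UNIV) \<le> (\<integral>\<^sup>+s. ennreal (pmf M s) \<partial>count_space UNIV)"
      by (intro nn_integral_mono) (auto simp: m_def)
    also have "\<dots> = 1" by (simp add: nn_integral_pmf)
    finally show ?thesis by (auto simp: less_top[symmetric] top_unique)
  qed
  \<comment> \<open>Monotonicity gives only sub-invariance; a step conserves the total mass, which
    is finite here, so no mass can be lost at any point.\<close>
  have inv: "push K m t = m t" for t
  proof (rule nn_integral_count_space_eq_imp_eq[OF _ _ fin])
    fix t
    have "push K m t \<le> push K (\<lambda>s. ennreal (pmf M s)) t" "push K m t \<le> push K (\<lambda>s. ennreal (pmf N s)) t"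
      by (auto intro!: push_mono simp: m_def)
    thus "push K m t \<le> m t"
      using M N by (simp add: bind_pmf_eq_self_iff_push m_def)
  qed (simp add: nn_integral_push_one)
  have attain: "m s = ennreal (pmf L s)"
    if L: "bind_pmf L K = L" "\<And>s. m s \<le> ennreal (pmf L s)" and a: "m a = ennreal (pmf L a)" for L s
    using reach[of s]
  proof (induction rule: converse_rtrancl_induct)
    case (step s t)
    hence pos: "pmf (K s) t > 0" by (simp add: set_pmf_iff pmf_pos)
    have Lt: "push K (\<lambda>s. ennreal (pmf L s)) t = ennreal (pmf L t)"
      using L(1) by (simp add: bind_pmf_eq_self_iff_push)
    \<comment> \<open>Both sums over predecessors of \<open>t\<close> have the same finite value and
      are ordered termwise, so they agree at \<open>s\<close>; the positive transition probability
      then cancels.\<close>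
    have "m s * pmf (K s) t = ennreal (pmf L s) * pmf (K s) t"
    proof (rule nn_integral_count_space_eq_imp_eq[where f = "\<lambda>s. m s * pmf (K s) t"
          and g = "\<lambda>s. ennreal (pmf L s) * pmf (K s) t"])
      show "m s * pmf (K s) t \<le> ennreal (pmf L s) * pmf (K s) t" for s
        by (intro mult_right_mono L(2)) auto
      show "(\<integral>\<^sup>+s. m s * pmf (K s) t \<partial>count_space UNIV) = (\<integral>\<^sup>+s. ennreal (pmf L s) * pmf (K s) t \<partial>count_space UNIV)"
        using inv[of t] Lt step.IH by (simp add: push_def)
      show "(\<integral>\<^sup>+s. ennreal (pmf L s) * pmf (K s) t \<partial>count_space UNIV) < \<infinity>"
        using Lt by (simp add: push_def)
    qed
    thus ?case using pos by (simp add: mult.commute[of _ "ennreal (pmf (K s) t)"] ennreal_mult_cancel_left)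
  qed (rule a)
  consider "m a = ennreal (pmf M a)" | "m a = ennreal (pmf N a)"
    unfolding m_def min_def by metis
  thus ?thesis
  proof cases
    case 1
    have "ennreal (pmf M s) \<le> ennreal (pmf N s)" for s
      using attain[OF M _ 1, of s] unfolding m_def by (metis min.cobounded1 min.cobounded2)
    thus ?thesis by (intro pmf_le_imp_eq) simp
  next
    case 2
    have "ennreal (pmf N s) \<le> ennreal (pmf M s)" for s
      using attain[OF N _ 2, of s] unfolding m_def by (metis min.cobounded1 min.cobounded2)
    thus ?thesis by (intro pmf_le_imp_eq[symmetric]) simp
  qed
qed

text \<open>The invariant law is the normalised expected occupation time of an excursion from \<open>a\<close>;
  the Lyapunov function \<open>G\<close> bounds the length of the excursion.\<close>

lemma invariant_pmf_exists:
  fixes K :: "'s::countable \<Rightarrow> 's pmf" and G :: "'s \<Rightarrow> ennreal"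
  assumes drift: "\<And>s. s \<noteq> a \<Longrightarrow> 1 + (\<integral>\<^sup>+t. G t \<partial>K s) \<le> G s"
    and fin: "(\<integral>\<^sup>+t. G t \<partial>K a) < \<infinity>"
  shows "\<exists>M. bind_pmf M K = M"
proof -
  \<comment> \<open>\<open>u n\<close> is the law at time \<open>n\<close> of the chain started in
    \<open>a\<close>, restricted to paths that have not returned to \<open>a\<close>.\<close>
  define u where "u = rec_nat (indicator {a}) (\<lambda>_ f t. if t = a then 0 else push K f t)"
  have u_0: "u 0 = indicator {a}" and u_Suc: "u (Suc n) t = (if t = a then 0 else push K (u n) t)" for n t
    by (simp_all add: u_def)
  define mass where "mass n = (\<integral>\<^sup>+s. u n s \<partial>count_space UNIV)" for n
  define pot where "pot n = (\<integral>\<^sup>+s. u n s * G s \<partial>count_space UNIV)" for n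
  have step: "pot (Suc n) \<le> (\<integral>\<^sup>+s. u n s * (\<integral>\<^sup>+t. G t \<partial>K s) \<partial>count_space UNIV)" for n
    unfolding pot_def nn_integral_push[symmetric]
    by (intro nn_integral_mono mult_right_mono) (auto simp: u_Suc)
  have pot_1: "pot (Suc 0) < \<infinity>"
  proof -
    have "(\<integral>\<^sup>+s. u 0 s * (\<integral>\<^sup>+t. G t \<partial>K s) \<partial>count_space UNIV) = (\<integral>\<^sup>+t. G t \<partial>K a)"
      by (subst mult.commute) (simp add: u_0 nn_integral_indicator_singleton)
    thus ?thesis using step[of 0] fin by (auto intro: le_less_trans)
  qed
  \<comment> \<open>Away from \<open>a\<close> the drift condition makes the potential fall by at
    least the current mass in each step, and \<open>u (Suc n)\<close> has no mass at
    \<open>a\<close>.\<close>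
  have mass_pot: "mass (Suc n) + pot (Suc (Suc n)) \<le> pot (Suc n)" for n
  proof -
    have "mass (Suc n) + pot (Suc (Suc n))
        \<le> (\<integral>\<^sup>+s. u (Suc n) s + u (Suc n) s * (\<integral>\<^sup>+t. G t \<partial>K s) \<partial>count_space UNIV)"
      unfolding mass_def by (subst nn_integral_add) (auto intro!: add_left_mono step)
    also have "\<dots> \<le> pot (Suc n)"
      unfolding pot_def
    proof (intro nn_integral_mono)
      fix s
      show "u (Suc n) s + u (Suc n) s * (\<integral>\<^sup>+t. G t \<partial>K s) \<le> u (Suc n) s * G s"
      proof (cases "s = a")
        case False
        thus ?thesis using mult_left_mono[OF drift[OF False], of "u (Suc n) s"]
          by (simp add: distrib_left)
      qed (simp add: u_Suc)
    qed
    finally show ?thesis .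
  qed
  have partial: "(\<Sum>k<n. mass (Suc k)) + pot (Suc n) \<le> pot (Suc 0)" for n
  proof (induction n)
    case (Suc n)
    have "(\<Sum>k<Suc n. mass (Suc k)) + pot (Suc (Suc n))
        = (\<Sum>k<n. mass (Suc k)) + (mass (Suc n) + pot (Suc (Suc n)))"
      by (simp add: add.assoc)
    also have "\<dots> \<le> (\<Sum>k<n. mass (Suc k)) + pot (Suc n)"
      by (intro add_left_mono mass_pot)
    finally show ?case using Suc by (rule order_trans)
  qed simp
  have "(\<Sum>k. mass (Suc k)) \<le> pot (Suc 0)"
    by (intro suminf_le_const summableI) (metis partial order_trans le_iff_add)
  moreover have mass_0: "mass 0 = 1"
    unfolding mass_def u_0 by (subst nn_integral_indicator) auto
  moreover have "(\<Sum>k. mass k) = mass 0 + (\<Sum>k. mass (Suc k))"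
    using suminf_offset[of mass 1] by (simp add: summableI)
  ultimately have mass_fin: "(\<Sum>k. mass k) < \<infinity>" and mass_pos: "(\<Sum>k. mass k) \<ge> 1"
    using pot_1 by (auto simp: less_top[symmetric] top_unique)
  define v where "v t = (\<Sum>n. u n t)" for t
  have int_v: "(\<integral>\<^sup>+s. v s \<partial>count_space UNIV) = (\<Sum>k. mass k)"
    unfolding v_def mass_def by (rule nn_integral_suminf) auto
  have push_v: "push K v t = (\<Sum>n. push K (u n) t)" for t
    unfolding push_def v_def
    by (subst nn_integral_suminf[symmetric]) (auto simp: ennreal_suminf_multc)
  have v_split: "v t = u 0 t + (\<Sum>n. u (Suc n) t)" for t
    unfolding v_def using suminf_offset[of "\<lambda>n. u n t" 1] by (simp add: summableI)
  have off: "push K v t = v t" if "t \<noteq> a" for t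
    using that by (simp add: v_split push_v u_0 u_Suc)
  \<comment> \<open>At \<open>a\<close> the recursion says nothing. Invariance there follows from
    conservation of mass: the mass off \<open>a\<close> is finite and the same before and after the
    step, so it cancels.\<close>
  have "push K v a = v a"
  proof -
    have "push K v a + (\<integral>\<^sup>+s. (if s = a then 0 else v s) \<partial>count_space UNIV)
        = (\<integral>\<^sup>+s. push K v s \<partial>count_space UNIV)"
      by (subst nn_integral_count_space_insert_point[of _ a]) (auto simp: off cong: if_cong)
    also have "\<dots> = v a + (\<integral>\<^sup>+s. (if s = a then 0 else v s) \<partial>count_space UNIV)"
      by (simp add: nn_integral_push_one nn_integral_count_space_insert_point[of v a])
    finally have eq: "push K v a + (\<integral>\<^sup>+s. (if s = a then 0 else v s) \<partial>count_space UNIV)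
       = v a + (\<integral>\<^sup>+s. (if s = a then 0 else v s) \<partial>count_space UNIV)" .
    have "(\<integral>\<^sup>+s. (if s = a then 0 else v s) \<partial>count_space UNIV) \<le> (\<integral>\<^sup>+s. v s \<partial>count_space UNIV)"
      by (intro nn_integral_mono) auto
    hence "(\<integral>\<^sup>+s. (if s = a then 0 else v s) \<partial>count_space UNIV) \<noteq> \<infinity>"
      using mass_fin int_v by (auto simp: top_unique)
    thus ?thesis using eq by (simp add: add.commute[of _ "\<integral>\<^sup>+s. (if s = a then 0 else v s) \<partial>count_space UNIV"] ennreal_add_left_cancel)
  qed
  with off have inv: "push K v t = v t" for t by (cases "t = a") auto
  define Z where "Z = enn2real (\<Sum>k. mass k)"
  have Z: "ennreal Z = (\<Sum>k. mass k)" using mass_fin by (simp add: Z_def)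
  have Zpos: "Z > 0" using mass_pos unfolding Z[symmetric]
    by (metis not_one_le_zero linorder_not_le ennreal_neg)
  have v_fin: "v t < \<infinity>" for t
    using nn_integral_count_space_insert_point[of v t] int_v mass_fin
    by (auto simp: less_top[symmetric])
  define w where "w t = enn2real (v t) / Z" for t
  have w: "ennreal (w t) = v t * ennreal (1 / Z)" for t
    using Zpos v_fin[of t] by (simp add: w_def divide_inverse ennreal_mult)
  have pmf_w: "pmf (embed_pmf w) t = w t" for t
  proof (rule pmf_embed_pmf)
    show "(\<integral>\<^sup>+x. ennreal (w x) \<partial>count_space UNIV) = 1"
      using Zpos by (simp add: w nn_integral_multc int_v Z[symmetric] ennreal_mult[symmetric])
  qed (use Zpos in \<open>auto simp: w_def\<close>)
  have "push K (\<lambda>s. v s * ennreal (1 / Z)) t = push K v t * ennreal (1 / Z)" for t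
    unfolding push_def by (subst nn_integral_multc[symmetric]) (auto simp: mult_ac)
  hence "bind_pmf (embed_pmf w) K = embed_pmf w"
    by (simp add: bind_pmf_eq_self_iff_push pmf_w w inv)
  thus ?thesis by blast
qed

section \<open>The uniformised chain of queue lengths\<close>

text \<open>Uniformisation: an event is a pair (service completion?, busy queue?), the second component
  mattering only for arrivals.\<close>

fun event_step :: "'c \<Rightarrow> bool \<times> bool \<Rightarrow> 'c state \<Rightarrow> 'c state" where
  "event_step z (v, b) x = (if v then complete_service x else if b then join_busy z x else join_idle z x)"

definition events :: "real \<Rightarrow> real \<Rightarrow> real \<Rightarrow> (bool \<times> bool) pmf" where
  "events lam mu p = pair_pmf (bernoulli_pmf (mu / (lam + mu))) (bernoulli_pmf p)"

definition kernel :: "real \<Rightarrow> real \<Rightarrow> real \<Rightarrow> unit state \<Rightarrow> unit state pmf" where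
  "kernel lam mu p s = map_pmf (\<lambda>e. event_step () e s) (events lam mu p)"

lemma nn_integral_events:
  assumes "0 < lam" "0 < mu" "p \<in> {0..1}"
  shows "(\<integral>\<^sup>+e. f (event_step z e x) \<partial>events lam mu p) =
    ennreal (mu / (lam + mu)) * f (complete_service x) +
    ennreal (lam * p / (lam + mu)) * f (join_busy z x) +
    ennreal (lam * (1 - p) / (lam + mu)) * f (join_idle z x)"
proof -
  have q: "0 \<le> mu / (lam + mu)" "mu / (lam + mu) \<le> 1" "1 - mu / (lam + mu) = lam / (lam + mu)"
    using assms by (auto simp: field_simps)
  have p: "ennreal p * c + ennreal (1 - p) * c = c" for c
    using assms by (simp add: distrib_right[symmetric] ennreal_plus[symmetric] del: ennreal_plus)
  have "(\<integral>\<^sup>+e. f (event_step z e x) \<partial>events lam mu p) =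
    ennreal (mu / (lam + mu)) * f (complete_service x) +
    ennreal (lam / (lam + mu)) * (ennreal p * f (join_busy z x) + ennreal (1 - p) * f (join_idle z x))"
    using assms q unfolding events_def
    by (simp add: nn_integral_pair_pmf' p mult.commute[of _ "ennreal _"])
  also have "\<dots> = ennreal (mu / (lam + mu)) * f (complete_service x) +
    ennreal (lam * p / (lam + mu)) * f (join_busy z x) +
    ennreal (lam * (1 - p) / (lam + mu)) * f (join_idle z x)"
    using assms by (simp add: distrib_left mult.assoc[symmetric] ennreal_mult[symmetric] add.assoc)
  finally show ?thesis .
qed

lemma nn_integral_bind_kernel:
  assumes "0 < lam" "0 < mu" "p \<in> {0..1}"
  shows "(\<integral>\<^sup>+s. f s \<partial>bind_pmf \<pi> (kernel lam mu p)) =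
    ennreal (mu / (lam + mu)) * (\<integral>\<^sup>+s. f (complete_service s) \<partial>\<pi>) +
    ennreal (lam * p / (lam + mu)) * (\<integral>\<^sup>+s. f (join_busy () s) \<partial>\<pi>) +
    ennreal (lam * (1 - p) / (lam + mu)) * (\<integral>\<^sup>+s. f (join_idle () s) \<partial>\<pi>)"
  using assms by (simp add: kernel_def nn_integral_events nn_integral_add nn_integral_cmult)

lemma pmf_bind_kernel:
  assumes "0 < lam" "0 < mu" "p \<in> {0..1}"
  shows "(lam + mu) * pmf (bind_pmf \<pi> (kernel lam mu p)) s =
      mu * measure_pmf.prob \<pi> {s'. complete_service s' = s}
    + lam * p * measure_pmf.prob \<pi> {s'. join_busy () s' = s}
    + lam * (1 - p) * measure_pmf.prob \<pi> {s'. join_idle () s' = s}"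
proof -
  have ind: "(\<integral>\<^sup>+s'. indicator {s} (h s') \<partial>\<pi>) = ennreal (measure_pmf.prob \<pi> {s'. h s' = s})"
    for h :: "unit state \<Rightarrow> unit state"
  proof -
    have "(\<integral>\<^sup>+s'. indicator {s} (h s') \<partial>\<pi>) = (\<integral>\<^sup>+s'. indicator {s'. h s' = s} s' \<partial>\<pi>)"
      by (intro nn_integral_cong) (auto simp: indicator_def)
    thus ?thesis by (simp add: measure_pmf.emeasure_eq_measure)
  qed
  have "ennreal (pmf (bind_pmf \<pi> (kernel lam mu p)) s) =
      ennreal (mu / (lam + mu) * measure_pmf.prob \<pi> {s'. complete_service s' = s}
    + lam * p / (lam + mu) * measure_pmf.prob \<pi> {s'. join_busy () s' = s}
    + lam * (1 - p) / (lam + mu) * measure_pmf.prob \<pi> {s'. join_idle () s' = s})"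
    using nn_integral_bind_kernel[OF assms, where f = "indicator {s}" and \<pi> = \<pi>] assms
    by (simp add: ind emeasure_pmf_single ennreal_mult[symmetric] ennreal_plus[symmetric]
        del: ennreal_plus nn_integral_bind_pmf)
  hence "pmf (bind_pmf \<pi> (kernel lam mu p)) s =
      mu / (lam + mu) * measure_pmf.prob \<pi> {s'. complete_service s' = s}
    + lam * p / (lam + mu) * measure_pmf.prob \<pi> {s'. join_busy () s' = s}
    + lam * (1 - p) / (lam + mu) * measure_pmf.prob \<pi> {s'. join_idle () s' = s}"
    using assms by (subst (asm) ennreal_inj) auto
  moreover have "(lam + mu) * (mu / (lam + mu) * A + lam * p / (lam + mu) * B + lam * (1 - p) / (lam + mu) * C)
     = mu * A + lam * p * B + lam * (1 - p) * C" for A B C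
    using assms by (simp add: distrib_left)
  ultimately show ?thesis by simp
qed

text \<open>Every move ends in \<open>settle\<close>, so invariant laws live on these states. On
  other states \<open>complete_service\<close> would exchange the queues; on settled ones a dummy
  service is a self-loop.\<close>

definition settled :: "'c state \<Rightarrow> bool" where
  "settled s \<longleftrightarrow> (fst s = [] \<longrightarrow> snd s = [])"

lemma settled_settle [simp]: "settled (settle s)"
  by (cases s) (auto simp: settled_def)

lemma settled_moves [simp]:
  "settled (join_busy z s)" "settled (join_idle z s)" "settled (complete_service s)"
  by (cases s; simp add: settled_def)+

lemma settled_event_step [simp]: "settled (event_step z e s)"
  by (cases e) simp

lemma settled_invariant:
  assumes "bind_pmf \<pi> (kernel lam mu p) = \<pi>" "s \<in> set_pmf \<pi>"
  shows "settled s"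
proof -
  have "s \<in> set_pmf (bind_pmf \<pi> (kernel lam mu p))" using assms by simp
  then obtain s' e where "s = event_step () e s'" unfolding kernel_def by fastforce
  thus ?thesis by simp
qed

text \<open>Both sides express global balance. The kernel adds dummy services at rate
  \<open>mu\<close> in the empty state; they enter outflow and inflow alike and cancel.\<close>

lemma stationary_iff_invariant:
  assumes "0 < lam" "0 < mu" "p \<in> {0..1}"
  shows "stationary lam mu p \<pi> \<longleftrightarrow> bind_pmf \<pi> (kernel lam mu p) = \<pi>"
proof -
  \<comment> \<open>Splits off the dummy services: on settled states an empty busy queue means an
    empty system, which \<open>complete_service\<close> fixes.\<close>
  have out: "mu * measure_pmf.prob \<pi> {s'. complete_service s' = s} =
       mu * measure_pmf.prob \<pi> {s'. fst s' \<noteq> [] \<and> complete_service s' = s}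
       + (if fst s = [] then mu * pmf \<pi> s else 0)"
    if supp: "\<And>s. s \<in> set_pmf \<pi> \<Longrightarrow> settled s" for s
  proof -
    have "measure_pmf.prob \<pi> {s'. complete_service s' = s} =
      measure_pmf.prob \<pi> {s'. fst s' \<noteq> [] \<and> complete_service s' = s}
      + measure_pmf.prob \<pi> {s'. fst s' = [] \<and> complete_service s' = s}"
      by (subst measure_pmf.finite_measure_Union[symmetric])
         (auto intro!: arg_cong2[where f = measure])
    also have "measure_pmf.prob \<pi> {s'. fst s' = [] \<and> complete_service s' = s}
      = measure_pmf.prob \<pi> (if fst s = [] then {s} else {})"
    proof (rule measure_pmf.finite_measure_eq_AE)
      show "AE x in \<pi>. (x \<in> {s'. fst s' = [] \<and> complete_service s' = s}) = (x \<in> (if fst s = [] then {s} else {}))"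
      proof (rule AE_pmfI)
        fix x assume "x \<in> set_pmf \<pi>"
        hence "settled x" by (rule supp)
        thus "(x \<in> {s'. fst s' = [] \<and> complete_service s' = s}) = (x \<in> (if fst s = [] then {s} else {}))"
          by (cases x; cases s) (auto simp: settled_def)
      qed
    qed auto
    also have "\<dots> = (if fst s = [] then pmf \<pi> s else 0)"
      by (simp add: measure_pmf_single)
    finally show ?thesis by (simp add: distrib_left)
  qed
  show ?thesis
  proof
    assume st: "stationary lam mu p \<pi>"
    have balance: "(lam + (if fst s \<noteq> [] then mu else 0)) * pmf \<pi> s =
          lam * p * measure_pmf.prob \<pi> {s'. join_busy () s' = s}
        + lam * (1 - p) * measure_pmf.prob \<pi> {s'. join_idle () s' = s}
        + mu * measure_pmf.prob \<pi> {s'. fst s' \<noteq> [] \<and> complete_service s' = s}" for s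
      using st unfolding stationary_def by blast
    have supp: "settled s" if "s \<in> set_pmf \<pi>" for s
    proof (rule ccontr)
      assume ns: "\<not> settled s"
      hence empty: "{s'. join_busy () s' = s} = {}" "{s'. join_idle () s' = s} = {}"
        "{s'. fst s' \<noteq> [] \<and> complete_service s' = s} = {}"
        using ns by (auto simp: settled_def)
      hence "(lam + (if fst s \<noteq> [] then mu else 0)) * pmf \<pi> s = 0"
        using balance[of s] by (simp only: empty) simp
      hence "pmf \<pi> s = 0" using assms by (auto split: if_splits)
      thus False using that by (simp add: set_pmf_iff)
    qed
    show "bind_pmf \<pi> (kernel lam mu p) = \<pi>"
    proof (rule pmf_eqI)
      fix s
      have "(lam + mu) * pmf (bind_pmf \<pi> (kernel lam mu p)) s = (lam + mu) * pmf \<pi> s"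
        using balance[of s] out[OF supp, of s] unfolding pmf_bind_kernel[OF assms]
        by (cases "fst s = []") (auto simp: algebra_simps)
      thus "pmf (bind_pmf \<pi> (kernel lam mu p)) s = pmf \<pi> s" using assms by simp
    qed
  next
    assume inv: "bind_pmf \<pi> (kernel lam mu p) = \<pi>"
    show "stationary lam mu p \<pi>"
      unfolding stationary_def
    proof
      fix s
      show "(lam + (if fst s \<noteq> [] then mu else 0)) * pmf \<pi> s =
            lam * p * measure_pmf.prob \<pi> {s'. join_busy () s' = s}
          + lam * (1 - p) * measure_pmf.prob \<pi> {s'. join_idle () s' = s}
          + mu * measure_pmf.prob \<pi> {s'. fst s' \<noteq> [] \<and> complete_service s' = s}"
        using pmf_bind_kernel[OF assms, of \<pi> s] out[OF settled_invariant[OF inv], of s] inv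
        by (cases "fst s = []") (auto simp: algebra_simps)
    qed
  qed
qed

section \<open>Total number of customers; existence and uniqueness of the steady state\<close>

definition total :: "'c state \<Rightarrow> nat" where
  "total s = length (fst s) + length (snd s)"

lemma total_join [simp]: "total (join_busy z s) = Suc (total s)" "total (join_idle z s) = Suc (total s)"
  by (cases s; auto simp: total_def)+

lemma total_complete_service: "settled s \<Longrightarrow> total (complete_service s) = total s - 1"
  by (cases s; cases "fst s") (auto simp: total_def settled_def)

lemma total_eq_0_iff: "total s = 0 \<longleftrightarrow> s = ([], [])"
  by (cases s) (auto simp: total_def)

lemma invariant_kernel_exists:
  assumes "0 < lam" "0 < mu" "lam < mu" "p \<in> {0..1}"
  shows "\<exists>\<pi>. bind_pmf \<pi> (kernel lam mu p) = \<pi>"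
proof (rule invariant_pmf_exists)
  \<comment> \<open>While customers are present, one event changes the total by
    \<open>(lam - mu) / (lam + mu)\<close> on average, so the factor \<open>C\<close> makes the mean
    drop of \<open>G\<close> exactly 1. The value \<open>top\<close> on unsettled states makes the
    drift condition trivial there.\<close>
  define C where "C = (lam + mu) / (mu - lam)"
  have C: "C > 0" using assms by (simp add: C_def)
  define G where "G s = (if settled s then ennreal (C * total s) else top)" for s :: "unit state"
  have int: "(\<integral>\<^sup>+t. G t \<partial>kernel lam mu p s) =
      ennreal (C * ((mu * (real (total s - 1)) + lam * (real (total s) + 1)) / (lam + mu)))" if "settled s" for s
  proof -
    have G_moves: "G (complete_service s) = ennreal (C * real (total s - 1))"
      "G (join_busy () s) = ennreal (C * (real (total s) + 1))"
      "G (join_idle () s) = ennreal (C * (real (total s) + 1))"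
      using that by (simp_all add: G_def total_complete_service add.commute)
    have "(\<integral>\<^sup>+t. G t \<partial>kernel lam mu p s) = ennreal (mu / (lam + mu) * (C * real (total s - 1)) +
       lam * p / (lam + mu) * (C * (real (total s) + 1)) + lam * (1 - p) / (lam + mu) * (C * (real (total s) + 1)))"
      using assms C unfolding kernel_def nn_integral_map_pmf
      by (subst nn_integral_events)
         (auto simp: G_moves ennreal_mult[symmetric] ennreal_plus[symmetric] simp del: ennreal_plus)
    also have "mu / (lam + mu) * (C * real (total s - 1)) +
       lam * p / (lam + mu) * (C * (real (total s) + 1)) + lam * (1 - p) / (lam + mu) * (C * (real (total s) + 1))
       = C * ((mu * (real (total s - 1)) + lam * (real (total s) + 1)) / (lam + mu))"
      using assms by (simp add: divide_simps) (simp add: algebra_simps)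
    finally show ?thesis .
  qed
  show "1 + (\<integral>\<^sup>+t. G t \<partial>kernel lam mu p s) \<le> G s" if "s \<noteq> ([], [])" for s
  proof (cases "settled s")
    case True
    have "total s \<noteq> 0" using that by (simp add: total_eq_0_iff)
    hence "real (total s - 1) = real (total s) - 1" by simp
    hence "1 + C * ((mu * (real (total s - 1)) + lam * (real (total s) + 1)) / (lam + mu)) = C * total s"
      using assms unfolding C_def by (simp add: divide_simps) (simp add: algebra_simps)
    moreover have "0 \<le> C * ((mu * (real (total s - 1)) + lam * (real (total s) + 1)) / (lam + mu))"
      using C assms by simp
    ultimately show ?thesis
      unfolding int[OF True] using True
      by (metis G_def ennreal_1 ennreal_plus order_refl zero_le_one)
  qed (simp add: G_def)
  show "(\<integral>\<^sup>+t. G t \<partial>kernel lam mu p ([], [])) < \<infinity>"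
    by (subst int) (auto simp: settled_def)
qed

text \<open>Repeated service completions empty the system, each having positive probability. The
  first one settles an arbitrary state; afterwards the total falls by one each time.\<close>

lemma kernel_reaches_empty:
  assumes "0 < lam" "0 < mu"
  shows "(s, ([], [])) \<in> {(s, t). t \<in> set_pmf (kernel lam mu p s)}\<^sup>*" (is "_ \<in> ?R\<^sup>*")
proof -
  have serve: "(s, complete_service s) \<in> ?R" for s
  proof -
    have "0 < mu / (lam + mu)" "mu / (lam + mu) < 1" using assms by auto
    hence "True \<in> set_pmf (bernoulli_pmf (mu / (lam + mu)))" by (simp add: set_pmf_bernoulli)
    moreover obtain b where "b \<in> set_pmf (bernoulli_pmf p)" using set_pmf_not_empty by fast
    ultimately have "(True, b) \<in> set_pmf (events lam mu p)" by (simp add: events_def)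
    thus ?thesis by (force simp: kernel_def image_iff)
  qed
  have "(s, ([], [])) \<in> ?R\<^sup>*" if "settled s" for s
    using that
  proof (induction "total s" arbitrary: s)
    case 0
    thus ?case by (simp add: total_eq_0_iff)
  next
    case (Suc n)
    hence "(complete_service s, ([], [])) \<in> ?R\<^sup>*"
      by (simp add: total_complete_service)
    thus ?case using serve by (rule converse_rtrancl_into_rtrancl[rotated])
  qed
  hence "(complete_service s, ([], [])) \<in> ?R\<^sup>*" by simp
  thus ?thesis using serve by (rule converse_rtrancl_into_rtrancl[rotated])
qed

text \<open>The drift argument gives existence and reachability of the empty state gives uniqueness,
  so the \<open>THE\<close> in \<open>steady_state\<close> denotes an actual law.\<close>

lemma steady_state_invariant:
  assumes "0 < lam" "0 < mu" "lam < mu" "p \<in> {0..1}"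
  shows "bind_pmf (steady_state lam mu p) (kernel lam mu p) = steady_state lam mu p"
proof -
  have "\<exists>!\<pi>. stationary lam mu p \<pi>"
    unfolding stationary_iff_invariant[OF assms(1,2,4)]
    using invariant_kernel_exists[OF assms] invariant_pmf_unique kernel_reaches_empty[OF assms(1,2)]
    by metis
  hence "stationary lam mu p (steady_state lam mu p)"
    unfolding steady_state_def by (rule theI')
  thus ?thesis by (simp only: stationary_iff_invariant[OF assms(1,2,4)])
qed

section \<open>Mean queue lengths\<close>

lemma nn_integral_geometric_power2_finite:
  assumes "0 < q" "q < 1"
  shows "(\<integral>\<^sup>+n. ennreal (real n ^ 2) \<partial>geometric_pmf q) < \<infinity>"
proof -
  \<comment> \<open>The coefficients \<open>(n + 1) * (n + 2)\<close> of the second derivative of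
    the geometric series dominate \<open>n ^ 2\<close>.\<close>
  have "summable (\<lambda>n. diffs (diffs (\<lambda>_. 1)) n * (1 - q) ^ n)"
  proof (rule termdiff_converges)
    show "norm (1 - q) < 1" using assms by simp
    fix x :: real assume "norm x < 1"
    thus "summable (\<lambda>n. diffs (\<lambda>_. 1) n * x ^ n)"
      by (intro termdiff_converges[of x 1]) (auto simp: summable_geometric)
  qed
  hence sm: "summable (\<lambda>n. real n ^ 2 * ((1 - q) ^ n * q))"
  proof (rule summable_comparison_test'[OF summable_mult2[of _ q]])
    fix n :: nat
    have "real n ^ 2 \<le> diffs (diffs (\<lambda>_. 1)) n"
      by (simp add: diffs_def power2_eq_square algebra_simps)
    thus "norm (real n ^ 2 * ((1 - q) ^ n * q)) \<le> diffs (diffs (\<lambda>_. 1)) n * (1 - q) ^ n * q"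
      using assms by (simp add: mult.assoc mult_right_mono)
  qed
  have "(\<integral>\<^sup>+n. ennreal (real n ^ 2) \<partial>geometric_pmf q) = (\<Sum>n. ennreal (real n ^ 2 * ((1 - q) ^ n * q)))"
    using assms by (simp add: nn_integral_measure_pmf nn_integral_count_space_nat ennreal_mult[symmetric] mult.commute)
  also have "\<dots> < \<infinity>"
    using sm assms by (simp add: suminf_ennreal2)
  finally show ?thesis .
qed

lemma nn_integral_geometric:
  assumes "0 < q" "q < 1"
  shows "(\<integral>\<^sup>+n. ennreal (real n) \<partial>geometric_pmf q) = ennreal ((1 - q) / q)"
  using expectation_geometric_pmf[of q] integrable_real_geometric_pmf[of q] assms
  by (subst nn_integral_eq_integral) auto

text \<open>Either route adds one customer, so \<open>p\<close> drops out and the total is a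
  birth-death chain.\<close>

lemma map_total_invariant:
  assumes "0 < lam" "lam < mu" and p: "p \<in> {0..1}" and inv: "bind_pmf \<pi> (kernel lam mu p) = \<pi>"
  shows "map_pmf total \<pi> = geometric_pmf (1 - lam / mu)"
proof -
  have mu: "0 < mu" using assms by simp
  have q: "0 < 1 - lam / mu" "1 - lam / mu \<le> 1" using assms by auto
  define P where "P n = pmf (map_pmf total \<pi>) n" for n
  have ind: "(\<integral>\<^sup>+s. indicator {n} (total s) \<partial>\<pi>) = ennreal (P n)" for n
    using nn_integral_map_pmf[where f = "indicator {n}" and g = total and M = \<pi>] by (simp add: P_def emeasure_pmf_single del: nn_integral_map_pmf)
  \<comment> \<open>In the empty system the service is a dummy and keeps the total at 0, whence the
    extra \<open>P 0\<close>.\<close>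
  have cs: "(\<integral>\<^sup>+s. indicator {n} (total (complete_service s)) \<partial>\<pi>)
      = ennreal (P (Suc n) + (if n = 0 then P 0 else 0))" for n
  proof -
    have "(\<integral>\<^sup>+s. indicator {n} (total (complete_service s)) \<partial>\<pi>)
       = (\<integral>\<^sup>+s. indicator {Suc n} (total s) + (if n = 0 then indicator {0} (total s) else 0) \<partial>\<pi>)"
      by (intro nn_integral_cong_AE AE_pmfI)
         (auto simp: total_complete_service settled_invariant[OF inv] indicator_def)
    also have "\<dots> = ennreal (P (Suc n)) + ennreal (if n = 0 then P 0 else 0)"
      by (subst nn_integral_add) (auto simp: ind)
    finally show ?thesis by (simp add: P_def)
  qed
  have join: "(\<integral>\<^sup>+s. indicator {n} (Suc (total s)) \<partial>\<pi>) = ennreal (if n = 0 then 0 else P (n - 1))" for n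
  proof -
    have "(\<integral>\<^sup>+s. indicator {n} (Suc (total s)) \<partial>\<pi>)
       = (\<integral>\<^sup>+s. (if n = 0 then 0 else indicator {n - 1} (total s)) \<partial>\<pi>)"
      by (intro nn_integral_cong) (auto simp: indicator_def)
    thus ?thesis by (auto simp: ind)
  qed
  have bal: "(lam + mu) * P n = mu * (P (Suc n) + (if n = 0 then P 0 else 0)) + lam * (if n = 0 then 0 else P (n - 1))" for n
  proof -
    have "ennreal (P n) = ennreal (mu / (lam + mu)) * ennreal (P (Suc n) + (if n = 0 then P 0 else 0)) +
      ennreal (lam * p / (lam + mu)) * ennreal (if n = 0 then 0 else P (n - 1)) +
      ennreal (lam * (1 - p) / (lam + mu)) * ennreal (if n = 0 then 0 else P (n - 1))"
      using nn_integral_bind_kernel[OF assms(1) mu p, where f = "\<lambda>s. indicator {n} (total s)" and \<pi> = \<pi>]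
      unfolding inv by (simp only: ind cs join total_join)
    also have "\<dots> = ennreal (mu / (lam + mu) * (P (Suc n) + (if n = 0 then P 0 else 0)) +
      lam * p / (lam + mu) * (if n = 0 then 0 else P (n - 1)) +
      lam * (1 - p) / (lam + mu) * (if n = 0 then 0 else P (n - 1)))"
      using assms mu by (simp add: ennreal_mult[symmetric] ennreal_plus[symmetric] P_def del: ennreal_plus)
    finally have "P n = mu / (lam + mu) * (P (Suc n) + (if n = 0 then P 0 else 0)) +
      lam * p / (lam + mu) * (if n = 0 then 0 else P (n - 1)) +
      lam * (1 - p) / (lam + mu) * (if n = 0 then 0 else P (n - 1))"
      using assms mu by (subst (asm) ennreal_inj) (auto simp: P_def)
    also have "\<dots> = (mu * (P (Suc n) + (if n = 0 then P 0 else 0)) + lam * (if n = 0 then 0 else P (n - 1))) / (lam + mu)"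
      using assms mu by (simp add: divide_simps) (simp add: algebra_simps)
    finally show ?thesis using assms mu by (simp add: field_simps)
  qed
  \<comment> \<open>Flow across the cut between \<open>n\<close> and \<open>n + 1\<close>; each
    balance equation passes it on to the next level.\<close>
  have cut: "mu * P (Suc n) = lam * P n" for n
  proof (induction n)
    case 0
    show ?case using bal[of 0] by (simp add: algebra_simps)
  next
    case (Suc n)
    thus ?case using bal[of "Suc n"] by (simp add: algebra_simps)
  qed
  have geo: "P n = (lam / mu) ^ n * P 0" for n
  proof (induction n)
    case (Suc n)
    have "P (Suc n) = lam / mu * P n" using cut[of n] mu by (simp add: field_simps)
    thus ?case using Suc by simp
  qed simp
  have pg: "pmf (geometric_pmf (1 - lam / mu)) n = (lam / mu) ^ n * (1 - lam / mu)" for n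
    using q by simp
  have le: "(lam / mu) ^ n \<ge> 0" for n using assms by simp
  \<comment> \<open>Both laws are multiples of \<open>(lam / mu) ^ n\<close>, so one lies below the
    other pointwise; having equal mass, they coincide.\<close>
  show ?thesis
  proof (cases "P 0 \<le> 1 - lam / mu")
    case True
    show ?thesis
    proof (rule pmf_le_imp_eq)
      show "pmf (map_pmf total \<pi>) n \<le> pmf (geometric_pmf (1 - lam / mu)) n" for n
        unfolding pg P_def[symmetric] by (subst geo) (rule mult_left_mono[OF True le])
    qed
  next
    case False
    hence ge: "1 - lam / mu \<le> P 0" by simp
    show ?thesis
    proof (rule pmf_le_imp_eq[symmetric])
      show "pmf (geometric_pmf (1 - lam / mu)) n \<le> pmf (map_pmf total \<pi>) n" for n
        unfolding pg P_def[symmetric] by (subst geo) (rule mult_left_mono[OF ge le])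
    qed
  qed
qed

lemma mean_queue_lengths:
  assumes lam: "0 < lam" "lam < mu" and p: "p \<in> {0..1}" and inv: "bind_pmf \<pi> (kernel lam mu p) = \<pi>"
  defines "L \<equiv> lam / (mu - lam)" and "D \<equiv> mu + lam - 2 * lam * p"
  shows "(\<integral>\<^sup>+s. ennreal (length (fst s)) \<partial>\<pi>) = ennreal (L * (mu - lam * p) / D)"
    and "(\<integral>\<^sup>+s. ennreal (length (snd s)) \<partial>\<pi>) = ennreal (L * (lam * (1 - p)) / D)"
proof -
  have mu: "0 < mu" using lam by simp
  have q: "0 < 1 - lam / mu" "1 - lam / mu < 1" using lam by auto
  have L: "(1 - (1 - lam / mu)) / (1 - lam / mu) = L" using lam by (simp add: L_def field_simps)
  have lp: "lam * p \<le> lam" using lam p by (simp add: mult_left_le)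
  have D: "D > 0" using lp lam unfolding D_def mult.assoc by linarith
  note law = map_total_invariant[OF assms(1-4)]
  define I where "I = (\<integral>\<^sup>+s. ennreal (length (fst s)) \<partial>\<pi>)"
  define J where "J = (\<integral>\<^sup>+s. ennreal (length (snd s)) \<partial>\<pi>)"
  \<comment> \<open>The product vanishes as soon as one queue is empty, so it does not see the
    exchange of roles in \<open>settle\<close>. On settled states each move changes it by the length
    of one queue, except for the dummy service, where that length is 0.\<close>
  define f where "f s = ennreal (real (length (fst s)) * real (length (snd s)))" for s :: "unit state"
  define F where "F = (\<integral>\<^sup>+s. f s \<partial>\<pi>)"
  define X where "X = (\<integral>\<^sup>+s. f (complete_service s) \<partial>\<pi>)"
  have "I + J = (\<integral>\<^sup>+s. ennreal (real (total s)) \<partial>\<pi>)"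
    unfolding I_def J_def by (subst nn_integral_add[symmetric]) (auto simp: total_def)
  also have "\<dots> = ennreal L"
    using nn_integral_map_pmf[where f = "\<lambda>n. ennreal (real n)" and g = total and M = \<pi>] nn_integral_geometric[OF q]
    unfolding law L by simp
  finally have IJ: "I + J = ennreal L" .
  have "F \<le> (\<integral>\<^sup>+s. ennreal (real (total s) ^ 2) \<partial>\<pi>)"
    unfolding F_def f_def total_def power2_eq_square
    by (intro nn_integral_mono ennreal_leI mult_mono) auto
  also have "\<dots> < \<infinity>"
    using nn_integral_map_pmf[where f = "\<lambda>n. ennreal (real n ^ 2)" and g = total and M = \<pi>] nn_integral_geometric_power2_finite[OF q]
    by (simp add: law)
  finally have F_fin: "F < \<infinity>" .
  have "X + J = (\<integral>\<^sup>+s. f (complete_service s) + ennreal (length (snd s)) \<partial>\<pi>)"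
    unfolding X_def J_def by (rule nn_integral_add[symmetric]) auto
  also have "\<dots> = F"
    unfolding F_def
  proof (intro nn_integral_cong_AE AE_pmfI)
    fix s assume "s \<in> set_pmf \<pi>"
    hence "settled s" by (rule settled_invariant[OF inv])
    thus "f (complete_service s) + ennreal (length (snd s)) = f s"
      by (cases s; cases "fst s")
         (auto simp: f_def settled_def algebra_simps ennreal_plus[symmetric] simp del: ennreal_plus)
  qed
  finally have XJ: "X + J = F" .
  have jb: "(\<integral>\<^sup>+s. f (join_busy () s) \<partial>\<pi>) = F + J"
    unfolding F_def J_def
    by (subst nn_integral_add[symmetric])
       (auto intro!: nn_integral_cong simp: f_def algebra_simps ennreal_plus[symmetric] simp del: ennreal_plus)
  have "(\<integral>\<^sup>+s. f (join_idle () s) \<partial>\<pi>) = (\<integral>\<^sup>+s. f s + ennreal (length (fst s)) \<partial>\<pi>)"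
  proof (intro nn_integral_cong)
    fix s :: "unit state"
    show "f (join_idle () s) = f s + ennreal (length (fst s))"
      by (cases s) (auto simp: f_def algebra_simps ennreal_plus[symmetric] simp del: ennreal_plus)
  qed
  hence ji: "(\<integral>\<^sup>+s. f (join_idle () s) \<partial>\<pi>) = F + I"
    unfolding F_def I_def by (simp add: nn_integral_add)
  have bal: "F = ennreal (mu / (lam + mu)) * X + ennreal (lam * p / (lam + mu)) * (F + J)
      + ennreal (lam * (1 - p) / (lam + mu)) * (F + I)"
    using nn_integral_bind_kernel[OF lam(1) mu p, where f = f and \<pi> = \<pi>]
    unfolding inv jb ji F_def[symmetric] X_def[symmetric] .
  \<comment> \<open>Finiteness of \<open>F\<close> carries over to \<open>X\<close>, so all
    quantities become reals and may be subtracted.\<close>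
  have "I < \<infinity>" "J < \<infinity>" "X < \<infinity>"
    using IJ XJ F_fin by (metis ennreal_less_top infinity_ennreal_def ennreal_add_eq_top less_top)+
  then obtain i j x where ijx: "I = ennreal i" "J = ennreal j" "X = ennreal x" "0 \<le> i" "0 \<le> j" "0 \<le> x"
    by (metis infinity_ennreal_def less_top_ennreal)
  have f: "F = ennreal (x + j)" using XJ ijx by simp
  have ij: "i + j = L"
  proof -
    have "ennreal (i + j) = ennreal L" using IJ ijx by simp
    thus ?thesis using ijx lam by (subst (asm) ennreal_inj) (auto simp: L_def)
  qed
  have "ennreal (x + j) = ennreal (mu / (lam + mu) * x + lam * p / (lam + mu) * (x + j + j)
      + lam * (1 - p) / (lam + mu) * (x + j + i))"
    using bal p lam mu ijx unfolding f
    by (simp add: ennreal_mult[symmetric] ennreal_plus[symmetric] del: ennreal_plus)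
  hence "x + j = mu / (lam + mu) * x + lam * p / (lam + mu) * (x + j + j)
      + lam * (1 - p) / (lam + mu) * (x + j + i)"
    using p lam mu ijx by (subst (asm) ennreal_inj) auto
  also have "\<dots> = (mu * x + lam * p * (x + j + j) + lam * (1 - p) * (x + j + i)) / (lam + mu)"
    by (simp add: add_divide_distrib)
  finally have "(lam + mu) * (x + j) = mu * x + lam * p * (x + j + j) + lam * (1 - p) * (x + j + i)"
    using lam mu by (simp add: field_simps)
  \<comment> \<open>\<open>x\<close> cancels, which leaves the relation between the two means.
    \<open>D\<close> is the sum of its coefficients, so inserting \<open>i + j = L\<close> solves
    for each mean.\<close>
  hence rel: "(mu - lam * p) * j = lam * (1 - p) * i" by (simp add: algebra_simps)
  have "D * j = L * (lam * (1 - p))" using rel unfolding ij[symmetric] D_def by (simp add: algebra_simps)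
  hence j: "j = L * (lam * (1 - p)) / D" using D by (simp add: field_simps)
  have "D * i = L * (mu - lam * p)" using rel unfolding ij[symmetric] D_def by (simp add: algebra_simps)
  hence i: "i = L * (mu - lam * p) / D" using D by (simp add: field_simps)
  show "(\<integral>\<^sup>+s. ennreal (length (fst s)) \<partial>\<pi>) = ennreal (L * (mu - lam * p) / D)"
    using i ijx by (simp add: I_def)
  show "(\<integral>\<^sup>+s. ennreal (length (snd s)) \<partial>\<pi>) = ennreal (L * (lam * (1 - p)) / D)"
    using j ijx by (simp add: J_def)
qed

section \<open>The cost of a tagged customer in the uniformised chain\<close>

text \<open>The one-step expectation operator on real functions, where telescoping may subtract; its
  \<open>n\<close>-th iterate is the expectation after \<open>n\<close> events.\<close>

definition next_mean ::
    "real \<Rightarrow> real \<Rightarrow> real \<Rightarrow> (customer state \<Rightarrow> real) \<Rightarrow> customer state \<Rightarrow> real" where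
  "next_mean lam mu p f x =
     (mu * f (complete_service x) + lam * p * f (join_busy Other x) + lam * (1 - p) * f (join_idle Other x))
       / (lam + mu)"

lemma next_mean_nonneg:
  assumes "0 < lam" "0 < mu" "p \<in> {0..1}" "\<And>x. 0 \<le> f x"
  shows "0 \<le> next_mean lam mu p f x"
  unfolding next_mean_def using assms by (intro divide_nonneg_nonneg add_nonneg_nonneg mult_nonneg_nonneg) auto

lemma next_mean_funpow_nonneg:
  assumes "0 < lam" "0 < mu" "p \<in> {0..1}" "\<And>x. 0 \<le> f x"
  shows "0 \<le> (next_mean lam mu p ^^ n) f x"
  using assms by (induction n arbitrary: x) (auto intro!: next_mean_nonneg)

lemma next_mean_add:
  "next_mean lam mu p (\<lambda>x. f x + g x) x = next_mean lam mu p f x + next_mean lam mu p g x"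
  unfolding next_mean_def add_divide_distrib[symmetric] by (simp add: algebra_simps)

lemma next_mean_sum:
  "next_mean lam mu p (\<lambda>x. \<Sum>k<n. f k x) x = (\<Sum>k<(n::nat). next_mean lam mu p (f k) x)"
proof (induction n)
  case 0
  show ?case by (simp add: next_mean_def)
qed (simp add: next_mean_add)

text \<open>The one-step cost equations hold only where the tag is placed consistently; closure lets
  them be iterated.\<close>

definition closed_under_moves :: "customer state set \<Rightarrow> bool" where
  "closed_under_moves S \<longleftrightarrow>
     (\<forall>x\<in>S. complete_service x \<in> S \<and> join_busy Other x \<in> S \<and> join_idle Other x \<in> S)"

lemma next_mean_cong:
  assumes "closed_under_moves S" "x \<in> S" "\<And>x. x \<in> S \<Longrightarrow> f x = g x"
  shows "next_mean lam mu p f x = next_mean lam mu p g x"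
  using assms by (simp add: next_mean_def closed_under_moves_def)

lemma next_mean_telescope:
  assumes cl: "closed_under_moves S"
    and eq: "\<And>x. x \<in> S \<Longrightarrow> g x = r x + next_mean lam mu p g x"
    and "x \<in> S"
  shows "g x = (\<Sum>k<n. (next_mean lam mu p ^^ k) r x) + (next_mean lam mu p ^^ n) g x"
  using \<open>x \<in> S\<close>
proof (induction n arbitrary: x)
  case (Suc n)
  have "g x = r x + next_mean lam mu p g x" using Suc.prems by (rule eq)
  also have "next_mean lam mu p g x = next_mean lam mu p
      (\<lambda>x. (\<Sum>k<n. (next_mean lam mu p ^^ k) r x) + (next_mean lam mu p ^^ n) g x) x"
    by (rule next_mean_cong[OF cl Suc.prems Suc.IH])
  also have "\<dots> = (\<Sum>k<n. (next_mean lam mu p ^^ Suc k) r x) + (next_mean lam mu p ^^ Suc n) g x"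
    by (simp add: next_mean_add next_mean_sum)
  finally show ?case unfolding sum.lessThan_Suc_shift by simp
qed simp

text \<open>The second-order potential \<open>G\<close> makes the remainder in the telescoped equation for \<open>g\<close> vanish.\<close>

lemma next_mean_sums:
  assumes par: "0 < lam" "0 < mu" "p \<in> {0..1}"
    and cl: "closed_under_moves S"
    and eq: "\<And>x. x \<in> S \<Longrightarrow> g x = r x + next_mean lam mu p g x"
    and pot: "\<And>x. x \<in> S \<Longrightarrow> G x = g x + next_mean lam mu p G x"
    and nonneg: "\<And>x. 0 \<le> g x" "\<And>x. 0 \<le> G x"
    and x: "x \<in> S"
  shows "(\<lambda>n. (next_mean lam mu p ^^ n) r x) sums g x"
proof -
  \<comment> \<open>Telescoping the equation for \<open>G\<close> bounds the partial sums of the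
    remainders by \<open>G x\<close>, so the remainders are summable and tend to 0.\<close>
  have "summable (\<lambda>n. (next_mean lam mu p ^^ n) g x)"
  proof (rule bounded_imp_summable)
    show "0 \<le> (next_mean lam mu p ^^ n) g x" for n
      by (rule next_mean_funpow_nonneg[OF par nonneg(1)])
    show "(\<Sum>k\<le>n. (next_mean lam mu p ^^ k) g x) \<le> G x" for n
    proof -
      have "0 \<le> (next_mean lam mu p ^^ Suc n) G x" by (rule next_mean_funpow_nonneg[OF par nonneg(2)])
      thus ?thesis using next_mean_telescope[OF cl pot x, where n = "Suc n"]
        unfolding lessThan_Suc_atMost by linarith
    qed
  qed
  hence "(\<lambda>n. (next_mean lam mu p ^^ n) g x) \<longlonglongrightarrow> 0" by (rule summable_LIMSEQ_zero)
  hence "(\<lambda>n. g x - (next_mean lam mu p ^^ n) g x) \<longlonglongrightarrow> g x - 0" by (intro tendsto_diff tendsto_const)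
  moreover have "g x - (next_mean lam mu p ^^ n) g x = (\<Sum>k<n. (next_mean lam mu p ^^ k) r x)" for n
    using next_mean_telescope[OF cl eq x, where n = n] by linarith
  ultimately show ?thesis by (simp add: sums_def)
qed

section \<open>Position of the tagged customer\<close>

definition ahead :: "customer list \<Rightarrow> nat" where
  "ahead xs = length (takeWhile (\<lambda>z. z \<noteq> Tagged) xs)"

lemma ahead_append [simp]: "Tagged \<in> set xs \<Longrightarrow> ahead (xs @ ys) = ahead xs"
  unfolding ahead_def by (subst takeWhile_append1) auto

lemma ahead_Cons [simp]: "ahead (x # xs) = (if x = Tagged then 0 else Suc (ahead xs))"
  by (simp add: ahead_def)

text \<open>\<open>u k\<close> is the value with \<open>k\<close> customers ahead in the busy queue, \<open>w i k\<close> with \<open>i\<close> customers in the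
  busy queue and \<open>k\<close> ahead in the idle queue.\<close>

definition position_value :: "(nat \<Rightarrow> real) \<Rightarrow> (nat \<Rightarrow> nat \<Rightarrow> real) \<Rightarrow> customer state \<Rightarrow> real" where
  "position_value u w x =
     (if Tagged \<in> set (fst x) then u (ahead (fst x))
      else if Tagged \<in> set (snd x) then w (length (fst x)) (ahead (snd x)) else 0)"

text \<open>At most one tag rather than exactly one: the set must stay closed after the tagged
  customer has left. A second tag would go on paying after the first has departed.\<close>

definition one_tag :: "customer state set" where
  "one_tag = {x. settled x \<and> count_list (fst x) Tagged + count_list (snd x) Tagged \<le> 1}"

lemma closed_one_tag: "closed_under_moves one_tag"
proof -
  have "count_list (tl xs) Tagged \<le> count_list xs Tagged" for xs
    by (cases xs) auto
  thus ?thesis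
    unfolding closed_under_moves_def one_tag_def settled_def
    by (auto intro: le_trans[OF add_right_mono])
qed

text \<open>Later arrivals stand behind the tag in her queue, so they never change \<open>k\<close>;
  only busy arrivals seen from the idle queue raise \<open>i\<close>. The value 0 at
  \<open>k = 0\<close> is the departure of the tagged customer, and the case \<open>i = 1\<close> is
  the server switching to her queue.\<close>

lemma next_mean_position_value:
  assumes "x \<in> one_tag"
  shows "next_mean lam mu p (position_value u w) x = position_value
     (\<lambda>k. (mu * (if k = 0 then 0 else u (k - 1)) + lam * u k) / (lam + mu))
     (\<lambda>i k. (mu * (if i = 1 then u k else w (i - 1) k) + lam * p * w (i + 1) k + lam * (1 - p) * w i k) / (lam + mu)) x"
proof -
  obtain xs ys where x: "x = (xs, ys)" by (cases x)
  show ?thesis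
  proof (cases xs)
    case Nil
    hence "ys = []" using assms x by (simp add: one_tag_def settled_def)
    thus ?thesis using Nil x by (simp add: next_mean_def position_value_def)
  next
    case (Cons z zs)
    have count: "count_list (z # zs) Tagged + count_list ys Tagged \<le> 1"
      using assms x Cons by (simp add: one_tag_def)
    have mem: "Tagged \<in> set l \<longleftrightarrow> count_list l Tagged \<noteq> 0" for l
      by (simp add: count_list_0_iff)
    consider "z = Tagged" "Tagged \<notin> set zs" "Tagged \<notin> set ys"
      | "z \<noteq> Tagged" "Tagged \<in> set zs" "Tagged \<notin> set ys"
      | "z \<noteq> Tagged" "Tagged \<notin> set zs"
      using count by (cases "z = Tagged"; cases "Tagged \<in> set zs") (auto simp: mem)
    thus ?thesis
    proof cases
      case 1
      thus ?thesis using x Cons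
        by (auto simp: next_mean_def position_value_def algebra_simps)
    next
      case 2
      hence "zs \<noteq> []" by auto
      thus ?thesis using 2 x Cons
        by (auto simp: next_mean_def position_value_def algebra_simps)
    next
      case 3
      thus ?thesis using x Cons
        by (auto simp: next_mean_def position_value_def algebra_simps)
    qed
  qed
qed

text \<open>In a settled state a tag in the idle queue forces a nonempty busy queue. The recurrences
  for \<open>w\<close> thus concern \<open>i \<ge> 1\<close>, where \<open>i - 1\<close> is not
  truncated.\<close>

lemma position_value_cong:
  assumes "x \<in> one_tag" "\<And>k. u k = u' k" "\<And>i k. 1 \<le> i \<Longrightarrow> w i k = w' i k"
  shows "position_value u w x = position_value u' w' x"
proof -
  have "Tagged \<in> set (snd x) \<Longrightarrow> 1 \<le> length (fst x)"
    using assms(1) by (cases "fst x") (auto simp: one_tag_def settled_def)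
  thus ?thesis by (auto simp: position_value_def assms)
qed

lemma position_value_add:
  "position_value u w x + position_value u' w' x
     = position_value (\<lambda>k. u k + u' k) (\<lambda>i k. w i k + w' i k) x"
  by (simp add: position_value_def)

lemma position_value_nonneg:
  "(\<And>k. 0 \<le> u k) \<Longrightarrow> (\<And>i k. 0 \<le> w i k) \<Longrightarrow> 0 \<le> position_value u w x"
  by (simp add: position_value_def)

text \<open>In the served queue she stays for \<open>k + 1\<close> services of mean
  \<open>1 / mu\<close>. The other term prices the mean busy period started by \<open>i\<close>
  customers: it is fed at rate \<open>lam * p\<close> only, so it drains at net rate
  \<open>mu - lam * p\<close>.\<close>

definition tag_cost :: "real \<Rightarrow> real \<Rightarrow> real \<Rightarrow> real \<Rightarrow> real \<Rightarrow> customer state \<Rightarrow> real" where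
  "tag_cost lam mu c d p = position_value (\<lambda>k. c * (real k + 1) / mu)
     (\<lambda>i k. d * real i / (mu - lam * p) + c * (real k + 1) / mu)"

lemma cost_rate_position_value: "cost_rate c d = position_value (\<lambda>_. c) (\<lambda>_ _. d)"
  by (rule ext) (simp add: cost_rate_def position_value_def)

lemma tag_cost_sums:
  assumes par: "0 < lam" "lam < mu" "p \<in> {0..1}" and cd: "0 \<le> c" "0 \<le> d" and x: "x \<in> one_tag"
  shows "(\<lambda>n. (next_mean lam mu p ^^ n) (\<lambda>x. cost_rate c d x / (lam + mu)) x) sums tag_cost lam mu c d p x"
proof -
  have mu: "0 < mu" using par by simp
  have "lam * p \<le> lam" using par by (simp add: mult_left_le)
  hence m: "0 < mu - lam * p" using par by linarith
  define t where "t = lam + mu"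
  have t: "t > 0" using par mu by (simp add: t_def)
  define \<gamma> where "\<gamma> = c / mu"
  define \<delta> where "\<delta> = d / (mu - lam * p)"
  have g: "\<gamma> \<ge> 0" "\<gamma> * mu = c" and d: "\<delta> \<ge> 0" "\<delta> * (mu - lam * p) = d"
    using cd mu m by (simp_all add: \<gamma>_def \<delta>_def)
  \<comment> \<open>Coefficients of the second-order potential, found by matching a polynomial
    ansatz to its one-step equation. \<open>\<beta>\<close> makes the increments of \<open>U\<close>
    equal to \<open>t * u k / mu\<close>. In \<open>W\<close>, \<open>A\<close> matches the term
    linear in \<open>i\<close>, \<open>A'\<close> removes the constant left by the square, and
    \<open>E\<close> matches the term in \<open>k + 1\<close>.\<close>
  define \<beta> where "\<beta> = \<gamma> * t / mu"
  define B where "B = \<delta> * t / (mu - lam * p)"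
  define A where "A = B / 2"
  define A' where "A' = A * (mu + lam * p) / (mu - lam * p)"
  define E where "E = \<gamma> * t / (mu - lam * p)"
  have b: "\<beta> \<ge> 0" "\<beta> * mu = \<gamma> * t" using g mu t by (simp_all add: \<beta>_def)
  have "B \<ge> 0" "B * (mu - lam * p) = \<delta> * t" using d m t by (simp_all add: B_def)
  hence A: "A \<ge> 0" "2 * A * (mu - lam * p) = \<delta> * t" by (simp_all add: A_def)
  have A': "A' \<ge> 0" "A' * (mu - lam * p) = A * (mu + lam * p)" using A m mu par by (simp_all add: A'_def)
  have E: "E \<ge> 0" "E * (mu - lam * p) = \<gamma> * t" using g m t by (simp_all add: E_def)
  define u where "u k = \<gamma> * (real k + 1)" for k :: nat
  define w where "w i k = \<delta> * real i + \<gamma> * (real k + 1)" for i k :: nat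
  define U where "U k = \<beta> * ((real k + 1) * (real k + 2) / 2)" for k :: nat
  define W where "W i k = U k + A * (real i)\<^sup>2 + A' * real i + E * real i * (real k + 1)" for i k :: nat
  have tc: "tag_cost lam mu c d p = position_value u w"
    by (simp add: tag_cost_def u_def[abs_def] w_def[abs_def] \<gamma>_def \<delta>_def)
  have rate: "cost_rate c d x / t = position_value (\<lambda>_. c / t) (\<lambda>_ _. d / t) x" for x
    by (simp add: cost_rate_position_value position_value_def)
  show ?thesis
    unfolding tc t_def[symmetric]
  proof (rule next_mean_sums[where S = one_tag and G = "position_value U W", OF par(1) mu par(3) closed_one_tag _ _ _ _ x])
    show "0 \<le> position_value u w x" for x
      by (rule position_value_nonneg) (use g d in \<open>auto simp: u_def w_def\<close>)
    have "0 \<le> U k" for k using b by (simp add: U_def)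
    thus "0 \<le> position_value U W x" for x
      by (intro position_value_nonneg) (use A A' E in \<open>auto simp: W_def\<close>)
    fix x assume x: "x \<in> one_tag"
    show "position_value u w x = cost_rate c d x / t + next_mean lam mu p (position_value u w) x"
      unfolding next_mean_position_value[OF x] rate position_value_add
    proof (rule position_value_cong[OF x])
      fix k :: nat
      have "t * u k = c + (mu * (if k = 0 then 0 else u (k - 1)) + lam * u k)"
        using g(2) by (cases k) (auto simp: u_def t_def algebra_simps)
      thus "u k = c / t + (mu * (if k = 0 then 0 else u (k - 1)) + lam * u k) / (lam + mu)"
        using t unfolding t_def[symmetric] add_divide_distrib[symmetric] by (simp add: field_simps)
    next
      fix i k :: nat assume "1 \<le> i"
      then obtain j where i: "i = Suc j" by (cases i) auto
      have "t * w i k = d + (mu * (if i = 1 then u k else w (i - 1) k) + lam * p * w (i + 1) k + lam * (1 - p) * w i k)"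
        using d(2) unfolding i by (cases j) (auto simp: u_def w_def t_def algebra_simps)
      thus "w i k = d / t + (mu * (if i = 1 then u k else w (i - 1) k) + lam * p * w (i + 1) k + lam * (1 - p) * w i k) / (lam + mu)"
        using t unfolding t_def[symmetric] add_divide_distrib[symmetric] by (simp add: field_simps)
    qed
    show "position_value U W x = position_value u w x + next_mean lam mu p (position_value U W) x"
      unfolding next_mean_position_value[OF x] position_value_add
    proof (rule position_value_cong[OF x])
      fix k :: nat
      \<comment> \<open>The triangular number is 0 at \<open>k = 0\<close>, so the departure of the
        tagged customer fits the general formula.\<close>
      have "(if k = 0 then 0 else U (k - 1)) = \<beta> * (real k * (real k + 1) / 2)"
        by (cases k) (auto simp: U_def algebra_simps)
      hence "mu * (if k = 0 then 0 else U (k - 1)) = (\<beta> * mu) * (real k * (real k + 1) / 2)" by simp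
      moreover have "mu * U k = (\<beta> * mu) * ((real k + 1) * (real k + 2) / 2)" by (simp add: U_def)
      ultimately have "t * U k = t * u k + (mu * (if k = 0 then 0 else U (k - 1)) + lam * U k)"
        unfolding b(2) u_def by (simp add: t_def field_simps)
      thus "U k = u k + (mu * (if k = 0 then 0 else U (k - 1)) + lam * U k) / (lam + mu)"
        using t unfolding t_def[symmetric] by (simp add: field_simps)
    next
      fix i k :: nat assume "1 \<le> i"
      then obtain j where i: "i = Suc j" by (cases i) auto
      \<comment> \<open>\<open>W 0 k\<close> equals \<open>U k\<close>, so the switch of the server
        fits the general recurrence.\<close>
      have W0: "(if i = 1 then U k else W (i - 1) k) = W j k" unfolding i by (auto simp: W_def)
      have "t * W i k - (mu * W j k + lam * p * W (i + 1) k + lam * (1 - p) * W i k)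
         = (2 * A * (mu - lam * p)) * real i + A' * (mu - lam * p) - A * (mu + lam * p) + (E * (mu - lam * p)) * (real k + 1)"
        unfolding i by (simp add: W_def t_def power2_eq_square algebra_simps)
      also have "\<dots> = t * w i k" unfolding A(2) A'(2) E(2) w_def by (simp add: algebra_simps)
      finally show "W i k = w i k + (mu * (if i = 1 then U k else W (i - 1) k) + lam * p * W (i + 1) k + lam * (1 - p) * W i k) / (lam + mu)"
        using t unfolding W0 t_def[symmetric] by (simp add: field_simps)
    qed
  qed
qed

section \<open>Competing exponential clocks\<close>

instance customer :: countable by countable_datatype

text \<open>The coordinates are independent because their joint law is the product measure itself,
  so the law of the minimum of independent exponentials applies.\<close>

lemma exponential_pair_distributed:
  assumes "0 < lam" "0 < mu"
  defines "W \<equiv> density lborel (exponential_density lam) \<Otimes>\<^sub>M density lborel (exponential_density mu)"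
  shows "distributed W lborel (\<lambda>x. min (fst x) (snd x)) (exponential_density (lam + mu))"
proof -
  define A where "A = density lborel (exponential_density lam)"
  define B where "B = density lborel (exponential_density mu)"
  interpret A: prob_space A unfolding A_def by (rule prob_space_exponential_density) fact
  interpret B: prob_space B unfolding B_def by (rule prob_space_exponential_density) fact
  interpret AB: pair_prob_space A B ..
  have W: "W = A \<Otimes>\<^sub>M B" by (simp add: W_def A_def B_def)
  have sets [measurable_cong]: "sets A = sets borel" "sets B = sets borel" by (simp_all add: A_def B_def)
  have fst: "distr (A \<Otimes>\<^sub>M B) borel fst = A"
    using B.distr_pair_fst[of A] by (simp cong: distr_cong add: sets)
  have snd: "distr (A \<Otimes>\<^sub>M B) borel snd = B"
  proof (rule measure_eqI)
    fix X assume "X \<in> sets (distr (A \<Otimes>\<^sub>M B) borel snd)"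
    hence X: "X \<in> sets borel" by simp
    have "emeasure (distr (A \<Otimes>\<^sub>M B) borel snd) X = emeasure (A \<Otimes>\<^sub>M B) (snd -` X \<inter> space (A \<Otimes>\<^sub>M B))"
      by (rule emeasure_distr) (use X in auto)
    also have "snd -` X \<inter> space (A \<Otimes>\<^sub>M B) = space A \<times> X"
      by (auto simp: space_pair_measure A_def B_def)
    also have "emeasure (A \<Otimes>\<^sub>M B) (space A \<times> X) = emeasure B X"
      using X by (subst B.emeasure_pair_measure_Times[OF sets.top]) (simp_all add: sets A.emeasure_space_1)
    finally show "emeasure (distr (A \<Otimes>\<^sub>M B) borel snd) X = emeasure B X" .
  qed (simp add: sets)
  show ?thesis unfolding W
  proof (rule AB.exponential_distributed_min[OF assms(1,2)])
    show "distributed (A \<Otimes>\<^sub>M B) lborel fst (exponential_density lam)"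
      unfolding distributed_def using fst by (simp add: A_def[symmetric] distr_cong[OF refl sets_lborel refl])
    show "distributed (A \<Otimes>\<^sub>M B) lborel snd (exponential_density mu)"
      unfolding distributed_def using snd by (simp add: B_def[symmetric] distr_cong[OF refl sets_lborel refl])
    show "AB.indep_var borel fst borel snd"
    proof -
      have "sets (borel \<Otimes>\<^sub>M borel) = sets (A \<Otimes>\<^sub>M B)"
        by (rule sets_pair_measure_cong) (simp_all add: sets)
      hence "A \<Otimes>\<^sub>M B = distr (A \<Otimes>\<^sub>M B) (borel \<Otimes>\<^sub>M borel) (\<lambda>x. (fst x, snd x))"
        by (simp add: distr_id2)
      thus ?thesis unfolding AB.indep_var_distribution_eq fst snd by auto
    qed
  qed
qed

text \<open>Given the service time \<open>s\<close>, the arrival clock exceeds it with probability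
  \<open>exp (- s * lam)\<close>. Times the density of \<open>s\<close> this is
  \<open>mu / (lam + mu)\<close> times the exponential density of rate \<open>lam + mu\<close>,
  which integrates to 1.\<close>

lemma nn_integral_exponential_race:
  assumes "0 < lam" "0 < mu"
  defines "W \<equiv> density lborel (exponential_density lam) \<Otimes>\<^sub>M density lborel (exponential_density mu)"
  shows "(\<integral>\<^sup>+x. F (snd x < fst x) \<partial>W)
    = ennreal (mu / (lam + mu)) * F True + ennreal (lam / (lam + mu)) * F False"
proof -
  define A where "A = density lborel (exponential_density lam)"
  define B where "B = density lborel (exponential_density mu)"
  interpret A: prob_space A unfolding A_def by (rule prob_space_exponential_density) fact
  interpret B: prob_space B unfolding B_def by (rule prob_space_exponential_density) fact
  interpret AB: pair_prob_space A B ..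
  have W: "W = A \<Otimes>\<^sub>M B" by (simp add: W_def A_def B_def)
  have sets [measurable_cong]: "sets A = sets borel" "sets B = sets borel" by (simp_all add: A_def B_def)
  have [simp]: "space A = UNIV" "space B = UNIV" by (simp_all add: A_def B_def)
  define X where "X = {x \<in> space (A \<Otimes>\<^sub>M B). snd x < fst x}"
  have X [measurable]: "X \<in> sets (A \<Otimes>\<^sub>M B)" unfolding X_def by measurable
  have tail: "emeasure A {s<..} = ennreal (exp (- s * lam))" if "0 \<le> s" for s
  proof -
    have "distributed A lborel (\<lambda>x. x) (exponential_density lam)"
      unfolding distributed_def by (simp add: A_def distr_id2)
    from A.exponential_distributedD_gt[OF this that assms(1)]
    show ?thesis by (simp add: A.emeasure_eq_measure greaterThan_def)
  qed
  have slice: "(\<lambda>a. (a, s)) -` X = {s<..}" for s by (auto simp: X_def space_pair_measure)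
  have [measurable]: "(\<lambda>s. emeasure A {s<..}) \<in> borel_measurable borel"
    using AB.measurable_emeasure_Pair2[OF X] unfolding slice by (simp add: B_def)
  have "emeasure (A \<Otimes>\<^sub>M B) X = (\<integral>\<^sup>+s. emeasure A {s<..} \<partial>B)"
    using AB.emeasure_pair_measure_alt2[OF X] unfolding slice .
  also have "\<dots> = (\<integral>\<^sup>+s. ennreal (exponential_density mu s) * emeasure A {s<..} \<partial>lborel)"
    unfolding B_def by (rule nn_integral_density) auto
  also have "\<dots> = (\<integral>\<^sup>+s. ennreal (mu / (lam + mu)) * ennreal (exponential_density (lam + mu) s) \<partial>lborel)"
  proof (intro nn_integral_cong)
    fix s :: real
    show "ennreal (exponential_density mu s) * emeasure A {s<..}
       = ennreal (mu / (lam + mu)) * ennreal (exponential_density (lam + mu) s)"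
    proof (cases "s < 0")
      case False
      have "mu * exp (- s * mu) * exp (- s * lam) = mu / (lam + mu) * ((lam + mu) * exp (- s * (lam + mu)))"
      proof -
        have "exp (- s * (lam + mu)) = exp (- s * mu) * exp (- s * lam)"
          unfolding mult_exp_exp by (simp add: algebra_simps)
        moreover have "mu / (lam + mu) * ((lam + mu) * r) = mu * r" for r using assms(1,2) by simp
        ultimately show ?thesis by (simp only: mult.assoc)
      qed
      thus ?thesis using False assms(1,2)
        by (simp add: tail exponential_density_def ennreal_mult[symmetric])
    qed (simp add: exponential_density_def)
  qed
  also have "\<dots> = ennreal (mu / (lam + mu)) * (\<integral>\<^sup>+s. ennreal (exponential_density (lam + mu) s) \<partial>lborel)"
    by (rule nn_integral_cmult) auto
  also have "(\<integral>\<^sup>+s. ennreal (exponential_density (lam + mu) s) \<partial>lborel) = 1"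
    using nn_integral_erlang_ith_moment[of "lam + mu" 0 0] assms by simp
  finally have PX: "emeasure (A \<Otimes>\<^sub>M B) X = ennreal (mu / (lam + mu))" by simp
  have "emeasure (A \<Otimes>\<^sub>M B) (space (A \<Otimes>\<^sub>M B) - X) = ennreal (1 - mu / (lam + mu))"
    using PX AB.prob_compl[OF X] assms by (simp add: AB.emeasure_eq_measure)
  also have "1 - mu / (lam + mu) = lam / (lam + mu)" using assms by (simp add: field_simps)
  finally have PXc: "emeasure (A \<Otimes>\<^sub>M B) (space (A \<Otimes>\<^sub>M B) - X) = ennreal (lam / (lam + mu))" .
  have "(\<integral>\<^sup>+x. F (snd x < fst x) \<partial>W)
    = (\<integral>\<^sup>+x. F True * indicator X x + F False * indicator (space (A \<Otimes>\<^sub>M B) - X) x \<partial>(A \<Otimes>\<^sub>M B))"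
    unfolding W
  proof (intro nn_integral_cong)
    fix x assume "x \<in> space (A \<Otimes>\<^sub>M B)"
    thus "F (snd x < fst x) = F True * indicator X x + F False * indicator (space (A \<Otimes>\<^sub>M B) - X) x"
      by (cases "snd x < fst x") (simp_all add: X_def indicator_def)
  qed
  also have "\<dots> = F True * emeasure (A \<Otimes>\<^sub>M B) X + F False * emeasure (A \<Otimes>\<^sub>M B) (space (A \<Otimes>\<^sub>M B) - X)"
    by (subst nn_integral_add) (auto simp: nn_integral_cmult_indicator)
  finally show ?thesis unfolding PX PXc by (simp add: mult.commute)
qed

section \<open>The law of a single driving event\<close>

lemma prob_space_clocks:
  assumes "0 < lam" "0 < mu"
  shows "prob_space (clocks lam mu p)"
proof -
  interpret A: prob_space "density lborel (exponential_density lam)"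
    by (rule prob_space_exponential_density) fact
  interpret B: prob_space "density lborel (exponential_density mu)"
    by (rule prob_space_exponential_density) fact
  interpret BP: pair_prob_space "density lborel (exponential_density mu)" "measure_pmf (bernoulli_pmf p)" ..
  interpret pair_prob_space "density lborel (exponential_density lam)"
    "density lborel (exponential_density mu) \<Otimes>\<^sub>M measure_pmf (bernoulli_pmf p)" ..
  show ?thesis unfolding clocks_def by (rule prob_space_axioms)
qed

text \<open>Moves the routing choice to the innermost integral, which leaves the two clocks alone to
  race.\<close>

lemma nn_integral_clocks:
  assumes "0 < lam" "0 < mu" and g: "g \<in> borel_measurable (clocks lam mu p)"
  shows "(\<integral>\<^sup>+e. g e \<partial>clocks lam mu p) = (\<integral>\<^sup>+x. (\<integral>\<^sup>+b. g (fst x, snd x, b) \<partial>bernoulli_pmf p)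
     \<partial>(density lborel (exponential_density lam) \<Otimes>\<^sub>M density lborel (exponential_density mu)))"
proof -
  define A where "A = density lborel (exponential_density lam)"
  define B where "B = density lborel (exponential_density mu)"
  define P where "P = measure_pmf (bernoulli_pmf p)"
  interpret A: prob_space A unfolding A_def by (rule prob_space_exponential_density) fact
  interpret B: prob_space B unfolding B_def by (rule prob_space_exponential_density) fact
  interpret P: prob_space P unfolding P_def by (rule measure_pmf.prob_space_axioms)
  interpret BP: pair_prob_space B P ..
  have C: "clocks lam mu p = A \<Otimes>\<^sub>M (B \<Otimes>\<^sub>M P)" by (simp add: clocks_def A_def B_def P_def)
  have [measurable]: "g \<in> borel_measurable (A \<Otimes>\<^sub>M (B \<Otimes>\<^sub>M P))" using g by (simp add: C)
  have "(\<integral>\<^sup>+e. g e \<partial>clocks lam mu p) = (\<integral>\<^sup>+a. \<integral>\<^sup>+y. g (a, y) \<partial>(B \<Otimes>\<^sub>M P) \<partial>A)"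
    unfolding C by (rule BP.nn_integral_fst[symmetric]) measurable
  also have "\<dots> = (\<integral>\<^sup>+a. \<integral>\<^sup>+s. \<integral>\<^sup>+b. g (a, s, b) \<partial>P \<partial>B \<partial>A)"
    by (intro nn_integral_cong P.nn_integral_fst[symmetric]) measurable
  also have "\<dots> = (\<integral>\<^sup>+x. (\<integral>\<^sup>+b. g (fst x, snd x, b) \<partial>P) \<partial>(A \<Otimes>\<^sub>M B))"
  proof -
    have "(\<lambda>x. \<integral>\<^sup>+b. g (fst x, snd x, b) \<partial>P) \<in> borel_measurable (A \<Otimes>\<^sub>M B)"
      by (rule P.borel_measurable_nn_integral) (unfold split_beta, measurable)
    from B.nn_integral_fst[OF this] show ?thesis by simp
  qed
  finally show ?thesis by (simp add: A_def B_def P_def)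
qed

lemma measurable_race [measurable]:
  "(\<lambda>e. (fst (snd e) < fst e, snd (snd e))) \<in> clocks lam mu p \<rightarrow>\<^sub>M count_space UNIV"
proof -
  have [measurable]: "(\<lambda>e. fst (snd e) < fst e) \<in> clocks lam mu p \<rightarrow>\<^sub>M count_space UNIV"
    "(\<lambda>e. snd (snd e)) \<in> clocks lam mu p \<rightarrow>\<^sub>M count_space UNIV"
    unfolding clocks_def by measurable
  show ?thesis by measurable
qed

lemma next_state_event_step: "next_state e x = event_step Other (fst (snd e) < fst e, snd (snd e)) x"
  by (cases e) simp

lemma measurable_next_state [measurable]:
  "(\<lambda>e. next_state e x) \<in> clocks lam mu p \<rightarrow>\<^sub>M count_space UNIV"
  unfolding next_state_event_step by measurable

lemma measurable_holding_time [measurable]: "holding_time \<in> borel_measurable (clocks lam mu p)"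
proof -
  have "holding_time = (\<lambda>e. min (fst e) (fst (snd e)))" by auto
  moreover have "(\<lambda>e. min (fst e) (fst (snd e))) \<in> borel_measurable (clocks lam mu p)"
    unfolding clocks_def by measurable
  ultimately show ?thesis by simp
qed

text \<open>The outcome of the race is Bernoulli with parameter \<open>mu / (lam + mu)\<close> and
  independent of the route, which is the law \<open>events\<close>.\<close>

lemma nn_integral_clocks_next_state:
  assumes "0 < lam" "0 < mu"
  shows "(\<integral>\<^sup>+e. f (next_state e x) \<partial>clocks lam mu p) = (\<integral>\<^sup>+e. f (event_step Other e x) \<partial>events lam mu p)"
proof -
  have q: "0 \<le> mu / (lam + mu)" "mu / (lam + mu) \<le> 1" "1 - mu / (lam + mu) = lam / (lam + mu)"
    using assms by (auto simp: field_simps)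
  define F where "F v = (\<integral>\<^sup>+b. f (event_step Other (v, b) x) \<partial>bernoulli_pmf p)" for v
  have "(\<integral>\<^sup>+e. f (next_state e x) \<partial>clocks lam mu p)
     = (\<integral>\<^sup>+y. F (snd y < fst y) \<partial>(density lborel (exponential_density lam) \<Otimes>\<^sub>M density lborel (exponential_density mu)))"
    by (subst nn_integral_clocks[OF assms]) (auto simp: F_def)
  also have "\<dots> = (\<integral>\<^sup>+e. f (event_step Other e x) \<partial>events lam mu p)"
    unfolding nn_integral_exponential_race[OF assms] events_def nn_integral_pair_pmf' F_def[symmetric]
    using q by (simp add: mult.commute)
  finally show ?thesis .
qed

lemma nn_integral_holding_time:
  assumes "0 < lam" "0 < mu"
  shows "(\<integral>\<^sup>+e. ennreal (holding_time e) \<partial>clocks lam mu p) = ennreal (1 / (lam + mu))"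
proof -
  have "(\<integral>\<^sup>+e. ennreal (holding_time e) \<partial>clocks lam mu p)
    = (\<integral>\<^sup>+y. ennreal (min (fst y) (snd y)) \<partial>(density lborel (exponential_density lam) \<Otimes>\<^sub>M density lborel (exponential_density mu)))"
    by (subst nn_integral_clocks[OF assms]) auto
  also have "\<dots> = (\<integral>\<^sup>+t. ennreal (exponential_density (lam + mu) t) * ennreal t \<partial>lborel)"
    by (rule distributed_nn_integral[OF exponential_pair_distributed[OF assms], symmetric]) simp
  also have "\<dots> = (\<integral>\<^sup>+t. ennreal (exponential_density (lam + mu) t * t ^ 1) \<partial>lborel)"
    using assms by (intro nn_integral_cong) (auto simp: ennreal_mult')
  also have "\<dots> = ennreal (1 / (lam + mu))"
    by (subst nn_integral_erlang_ith_moment) (use assms in auto)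
  finally show ?thesis .
qed

section \<open>The social cost\<close>

text \<open>Peels off the first event, whereas the definition recurses on the last; integrals over
  \<open>stream_space\<close> split at the front.\<close>

lemma state_after_Stream: "state_after x (e ## \<omega>) (Suc n) = state_after (next_state e x) \<omega> n"
  by (induction n) simp_all

lemma measurable_state_after [measurable]:
  "(\<lambda>\<omega>. state_after x \<omega> n) \<in> stream_space (clocks lam mu p) \<rightarrow>\<^sub>M count_space UNIV"
proof (induction n)
  case (Suc n)
  show ?case
    unfolding state_after.simps
    by (rule measurable_compose_countable[OF _ Suc]) measurable
qed simp

text \<open>The clocks of event \<open>n\<close> determine both the holding time and the next state,
  but the current state depends on earlier events only. So the mean holding time
  \<open>1 / (lam + mu)\<close> factors out; the induction integrates away the first event.\<close>

lemma nn_integral_cost_rate_after: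
  assumes "0 < lam" "0 < mu" "p \<in> {0..1}" and r: "\<And>x. 0 \<le> r x"
  shows "(\<integral>\<^sup>+\<omega>. ennreal (r (state_after x \<omega> n) * holding_time (\<omega> !! n)) \<partial>stream_space (clocks lam mu p))
    = ennreal ((next_mean lam mu p ^^ n) (\<lambda>x. r x / (lam + mu)) x)"
proof -
  interpret C: prob_space "clocks lam mu p" by (rule prob_space_clocks) fact+
  interpret S: prob_space "stream_space (clocks lam mu p)" by (rule C.prob_space_stream_space)
  have meas [measurable]: "(\<lambda>\<omega>. ennreal (r (state_after x \<omega> n) * holding_time (\<omega> !! n)))
      \<in> borel_measurable (stream_space (clocks lam mu p))" for x n
    by measurable
  show ?thesis
  proof (induction n arbitrary: x)
    case 0
    have "(\<integral>\<^sup>+\<omega>. ennreal (r (state_after x \<omega> 0) * holding_time (\<omega> !! 0)) \<partial>stream_space (clocks lam mu p))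
        = (\<integral>\<^sup>+e. ennreal (r x) * ennreal (holding_time e) \<partial>clocks lam mu p)"
      by (subst C.nn_integral_stream_space[OF meas])
         (simp add: S.emeasure_space_1 ennreal_mult'[OF r] del: holding_time.simps)
    also have "\<dots> = ennreal (r x) * ennreal (1 / (lam + mu))"
      by (simp add: nn_integral_cmult nn_integral_holding_time assms del: holding_time.simps)
    finally show ?case using r[of x] assms by (simp add: ennreal_mult[symmetric])
  next
    case (Suc n)
    let ?K = "next_mean lam mu p" and ?r = "\<lambda>x. r x / (lam + mu)"
    have nn: "0 \<le> (?K ^^ n) ?r x" for x
      by (rule next_mean_funpow_nonneg) (use assms in auto)
    have "(\<integral>\<^sup>+\<omega>. ennreal (r (state_after x \<omega> (Suc n)) * holding_time (\<omega> !! Suc n)) \<partial>stream_space (clocks lam mu p))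
        = (\<integral>\<^sup>+e. ennreal ((?K ^^ n) ?r (next_state e x)) \<partial>clocks lam mu p)"
      by (subst C.nn_integral_stream_space[OF meas])
         (simp only: state_after_Stream snth_Stream Suc.IH)
    also have "\<dots> = (\<integral>\<^sup>+e. ennreal ((?K ^^ n) ?r (event_step Other e x)) \<partial>events lam mu p)"
      by (rule nn_integral_clocks_next_state) fact+
    also have "\<dots> = ennreal (mu / (lam + mu) * (?K ^^ n) ?r (complete_service x)
        + lam * p / (lam + mu) * (?K ^^ n) ?r (join_busy Other x)
        + lam * (1 - p) / (lam + mu) * (?K ^^ n) ?r (join_idle Other x))"
      using assms nn
      by (simp only: nn_integral_events[OF assms(1-3), where f = "\<lambda>x. ennreal ((?K ^^ n) ?r x)"])
         (simp add: ennreal_mult[symmetric] ennreal_plus[symmetric] del: ennreal_plus)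
    also have "\<dots> = ennreal ((?K ^^ Suc n) ?r x)"
      by (simp add: next_mean_def add_divide_distrib)
    finally show ?case .
  qed
qed

lemma expected_cost_eq_tag_cost:
  assumes par: "0 < lam" "lam < mu" "p \<in> {0..1}" and cd: "0 \<le> c" "0 \<le> d" and x: "x \<in> one_tag"
  shows "expected_cost lam mu c d p x = ennreal (tag_cost lam mu c d p x)"
proof -
  have mu: "0 < mu" using par by simp
  have r: "0 \<le> cost_rate c d x" for x using cd by (simp add: cost_rate_def)
  have "expected_cost lam mu c d p x = (\<Sum>n. \<integral>\<^sup>+\<omega>. ennreal (cost_rate c d (state_after x \<omega> n) * holding_time (\<omega> !! n))
      \<partial>stream_space (clocks lam mu p))"
    unfolding expected_cost_def by (rule nn_integral_suminf) measurable
  also have "\<dots> = (\<Sum>n. ennreal ((next_mean lam mu p ^^ n) (\<lambda>x. cost_rate c d x / (lam + mu)) x))"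
    by (simp only: nn_integral_cost_rate_after[where r = "cost_rate c d", OF par(1) mu par(3) r])
  also have "\<dots> = ennreal (tag_cost lam mu c d p x)"
  proof (rule suminf_ennreal_eq[OF _ tag_cost_sums[OF par cd x]])
    show "0 \<le> (next_mean lam mu p ^^ n) (\<lambda>x. cost_rate c d x / (lam + mu)) x" for n
      by (rule next_mean_funpow_nonneg[OF par(1) mu par(3)]) (use r par mu in auto)
  qed
  finally show ?thesis .
qed

section \<open>The tagged arrival in steady state\<close>

lemma others_simp [simp]: "others (xs, ys) = (map (\<lambda>_. Other) xs, map (\<lambda>_. Other) ys)"
  by (simp add: others_def)

lemma count_map_Other [simp]: "count_list (map (\<lambda>_. Other) xs) Tagged = 0"
  by (induction xs) auto

lemma ahead_map_Other [simp]: "ahead (map (\<lambda>_. Other) xs @ [Tagged]) = length xs"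
  by (induction xs) auto

lemma join_others_one_tag:
  "settled s \<Longrightarrow> join_busy Tagged (others s) \<in> one_tag"
  "settled s \<Longrightarrow> join_idle Tagged (others s) \<in> one_tag"
  by (cases s; auto simp: one_tag_def settled_def)+

text \<open>In the empty system a customer joining the idle queue is served at once; both lengths
  are then 0 and the second formula still gives \<open>c / mu\<close>.\<close>

lemma tag_cost_join:
  assumes "settled s"
  shows "tag_cost lam mu c d p (join_busy Tagged (others s)) = c * (real (length (fst s)) + 1) / mu"
    and "tag_cost lam mu c d p (join_idle Tagged (others s))
       = d * real (length (fst s)) / (mu - lam * p) + c * (real (length (snd s)) + 1) / mu"
  using assms by (cases s; auto simp: tag_cost_def position_value_def settled_def)+

text \<open>The tag costs are affine in the queue lengths found on arrival, so the two means
  suffice.\<close>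

lemma cost_components:
  assumes par: "0 < lam" "lam < mu" "p \<in> {0..1}" and cd: "0 \<le> c" "0 \<le> d"
  defines "L \<equiv> lam / (mu - lam)" and "D \<equiv> mu + lam - 2 * lam * p"
  shows "cost_busy lam mu c d p = ennreal (c * (L * (mu - lam * p) / D + 1) / mu)"
    and "cost_idle lam mu c d p
      = ennreal (d * (L * (mu - lam * p) / D) / (mu - lam * p) + c * (L * (lam * (1 - p)) / D + 1) / mu)"
proof -
  have mu: "0 < mu" using par by simp
  have lp: "lam * p \<le> lam" using par by (simp add: mult_left_le)
  have m: "0 < mu - lam * p" using lp par by linarith
  have D: "D > 0" using lp par unfolding D_def mult.assoc by linarith
  have L: "L > 0" using par by (simp add: L_def)
  let ?\<pi> = "steady_state lam mu p"
  note inv = steady_state_invariant[OF par(1) mu par(2,3)]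
  note EI = mean_queue_lengths(1)[OF par inv, folded L_def D_def]
  note EJ = mean_queue_lengths(2)[OF par inv, folded L_def D_def]
  have "cost_busy lam mu c d p
      = (\<integral>\<^sup>+s. ennreal (c / mu) * ennreal (length (fst s)) + ennreal (c / mu) \<partial>?\<pi>)"
    unfolding cost_busy_def
  proof (intro nn_integral_cong_AE AE_pmfI)
    fix s assume "s \<in> set_pmf ?\<pi>"
    hence s: "settled s" by (rule settled_invariant[OF inv])
    have "expected_cost lam mu c d p (join_busy Tagged (others s)) = ennreal (c * (real (length (fst s)) + 1) / mu)"
      by (simp add: expected_cost_eq_tag_cost[OF par cd join_others_one_tag(1)[OF s]] tag_cost_join(1)[OF s])
    also have "\<dots> = ennreal (c / mu) * ennreal (length (fst s)) + ennreal (c / mu)"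
      using cd mu by (simp add: ennreal_mult[symmetric] ennreal_plus[symmetric] field_simps del: ennreal_plus)
    finally show "expected_cost lam mu c d p (join_busy Tagged (others s))
        = ennreal (c / mu) * ennreal (length (fst s)) + ennreal (c / mu)" .
  qed
  also have "\<dots> = ennreal (c / mu) * ennreal (L * (mu - lam * p) / D) + ennreal (c / mu)"
    by (simp add: nn_integral_add nn_integral_cmult EI)
  also have "\<dots> = ennreal (c / mu * (L * (mu - lam * p) / D) + c / mu)"
    using cd mu L m D by (simp add: ennreal_mult[symmetric] ennreal_plus[symmetric] del: ennreal_plus)
  also have "c / mu * (L * (mu - lam * p) / D) + c / mu = c * (L * (mu - lam * p) / D + 1) / mu"
    by (simp add: add_divide_distrib distrib_left)
  finally show "cost_busy lam mu c d p = ennreal (c * (L * (mu - lam * p) / D + 1) / mu)" .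
  have "cost_idle lam mu c d p
      = (\<integral>\<^sup>+s. ennreal (d / (mu - lam * p)) * ennreal (length (fst s))
          + (ennreal (c / mu) * ennreal (length (snd s)) + ennreal (c / mu)) \<partial>?\<pi>)"
    unfolding cost_idle_def
  proof (intro nn_integral_cong_AE AE_pmfI)
    fix s assume "s \<in> set_pmf ?\<pi>"
    hence s: "settled s" by (rule settled_invariant[OF inv])
    have "expected_cost lam mu c d p (join_idle Tagged (others s))
        = ennreal (d * real (length (fst s)) / (mu - lam * p) + c * (real (length (snd s)) + 1) / mu)"
      by (simp add: expected_cost_eq_tag_cost[OF par cd join_others_one_tag(2)[OF s]] tag_cost_join(2)[OF s])
    also have "\<dots> = ennreal (d / (mu - lam * p) * length (fst s) + (c / mu * length (snd s) + c / mu))"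
      by (simp add: add_divide_distrib distrib_left)
    also have "\<dots> = ennreal (d / (mu - lam * p)) * ennreal (length (fst s))
          + (ennreal (c / mu) * ennreal (length (snd s)) + ennreal (c / mu))"
      using cd mu m by (simp add: ennreal_mult[symmetric] ennreal_plus[symmetric] del: ennreal_plus)
    finally show "expected_cost lam mu c d p (join_idle Tagged (others s))
        = ennreal (d / (mu - lam * p)) * ennreal (length (fst s))
          + (ennreal (c / mu) * ennreal (length (snd s)) + ennreal (c / mu))" .
  qed
  also have "\<dots> = ennreal (d / (mu - lam * p)) * ennreal (L * (mu - lam * p) / D)
      + (ennreal (c / mu) * ennreal (L * (lam * (1 - p)) / D) + ennreal (c / mu))"
    by (simp add: nn_integral_add nn_integral_cmult EI EJ)
  also have "\<dots> = ennreal (d / (mu - lam * p) * (L * (mu - lam * p) / D) + (c / mu * (L * (lam * (1 - p)) / D) + c / mu))"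
    using cd mu L m D par by (simp add: ennreal_mult[symmetric] ennreal_plus[symmetric] del: ennreal_plus)
  also have "d / (mu - lam * p) * (L * (mu - lam * p) / D) + (c / mu * (L * (lam * (1 - p)) / D) + c / mu)
    = d * (L * (mu - lam * p) / D) / (mu - lam * p) + c * (L * (lam * (1 - p)) / D + 1) / mu"
    by (simp only: add_divide_distrib distrib_left times_divide_eq_left mult_1_right)
  finally show "cost_idle lam mu c d p
      = ennreal (d * (L * (mu - lam * p) / D) / (mu - lam * p) + c * (L * (lam * (1 - p)) / D + 1) / mu)" .
qed

definition mean_idle :: "real \<Rightarrow> real \<Rightarrow> real \<Rightarrow> real" where
  "mean_idle lam mu p = lam / (mu - lam) * (lam * (1 - p)) / (mu + lam - 2 * lam * p)"

lemma cost_eq: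
  assumes par: "0 < lam" "lam < mu" "p \<in> {0..1}" and cd: "0 \<le> c" "0 \<le> d"
  shows "cost lam mu c d p = ennreal ((c * (lam / (mu - lam) - mean_idle lam mu p) + d * mean_idle lam mu p) / lam)"
proof -
  have mu: "0 < mu" using par by simp
  define m where "m = mu - lam * p"
  define D where "D = mu + lam - 2 * lam * p"
  define L where "L = lam / (mu - lam)"
  have lp: "lam * p \<le> lam" using par by (simp add: mult_left_le)
  have m: "0 < m" using lp par unfolding m_def by linarith
  have D: "D > 0" using lp par unfolding D_def mult.assoc by linarith
  have L: "L > 0" "lam = L * (mu - lam)" using par by (simp_all add: L_def)
  define I where "I = L * m / D"
  define J where "J = L * (lam * (1 - p)) / D"
  have I: "0 \<le> I" "I * D = L * m" using L m D by (simp_all add: I_def)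
  have J: "0 \<le> J" "J * D = L * (lam * (1 - p))" using L par D by (simp_all add: J_def)
  have IJ: "I + J = L"
  proof -
    have "(I + J) * D = L * D" using I(2) J(2) by (simp add: m_def D_def algebra_simps)
    thus ?thesis using D by simp
  qed
  \<comment> \<open>Little's law for the busy queue: an arrival spends
    \<open>(1 + p * I + (1 - p) * J) / mu\<close> on average in a queue being served.\<close>
  have key: "lam * (1 + p * I + (1 - p) * J) = mu * I"
  proof -
    have "lam * (1 + p * I + (1 - p) * J) * D = lam * D + lam * (p * (I * D) + (1 - p) * (J * D))"
      by (simp add: algebra_simps)
    also have "lam * D = L * (mu - lam) * D" using L(2) by simp
    also have "L * (mu - lam) * D + lam * (p * (I * D) + (1 - p) * (J * D)) = mu * (L * m)"
      unfolding I(2) J(2) by (simp add: m_def D_def algebra_simps)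
    also have "\<dots> = mu * I * D" using I(2) by simp
    finally show ?thesis using D by simp
  qed
  \<comment> \<open>Little's law for the idle queue: it is entered at rate
    \<open>lam * (1 - p)\<close>, and the wait for the server has mean \<open>I / m\<close>.\<close>
  have wait: "lam * (1 - p) * (I / m) = J" using m by (simp add: I_def J_def)
  have "cost lam mu c d p = ennreal (p * (c * (I + 1) / mu) + (1 - p) * (d * I / m + c * (J + 1) / mu))"
    using par cd I J m mu
    unfolding cost_def cost_components[OF par cd, folded m_def D_def L_def, folded I_def J_def]
    by (simp add: ennreal_mult[symmetric] ennreal_plus[symmetric] del: ennreal_plus)
  also have "p * (c * (I + 1) / mu) + (1 - p) * (d * I / m + c * (J + 1) / mu)
      = (c * (lam * (1 + p * I + (1 - p) * J)) / mu + d * (lam * (1 - p) * (I / m))) / lam"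
    using par mu m by (simp add: field_simps)
  also have "\<dots> = (c * (L - J) + d * J) / lam"
    unfolding key wait using IJ mu by auto
  finally show ?thesis by (simp add: L_def J_def D_def mean_idle_def)
qed

text \<open>Up to a positive factor the function is a quotient of affine functions of
  \<open>p\<close>; cross-multiplication leaves \<open>(q - p) * (mu - lam)\<close>, so stability
  gives the sign.\<close>

lemma mean_idle_strict_antimono:
  assumes "0 < lam" "lam < mu" "0 \<le> p" "p < q" "q \<le> 1"
  shows "mean_idle lam mu q < mean_idle lam mu p"
proof -
  have D: "0 < mu + lam - 2 * lam * r" if "r \<le> 1" for r
  proof -
    have "lam * r \<le> lam" using assms that by (simp add: mult_left_le)
    thus ?thesis using assms unfolding mult.assoc by linarith
  qed
  have "(1 - q) * (mu + lam - 2 * lam * p) < (1 - p) * (mu + lam - 2 * lam * q)"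
  proof -
    have "(1 - p) * (mu + lam - 2 * lam * q) - (1 - q) * (mu + lam - 2 * lam * p) = (q - p) * (mu - lam)"
      by (simp add: algebra_simps)
    moreover have "0 < (q - p) * (mu - lam)" using assms by simp
    ultimately show ?thesis by linarith
  qed
  hence "(1 - q) / (mu + lam - 2 * lam * q) < (1 - p) / (mu + lam - 2 * lam * p)"
    using D[of p] D[of q] assms by (simp add: divide_simps)
  hence "lam / (mu - lam) * lam * ((1 - q) / (mu + lam - 2 * lam * q))
      < lam / (mu - lam) * lam * ((1 - p) / (mu + lam - 2 * lam * p))"
    using assms by (intro mult_strict_left_mono) auto
  thus ?thesis by (simp add: mean_idle_def mult.assoc)
qed

theorem theorem4p2:
  fixes lam mu c d :: real
  assumes "0 < lam" and "0 < mu" and "lam / mu < 1" and "0 < c" and "0 \<le> d"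
  shows "(c > d \<longrightarrow> {p. socially_optimal lam mu c d p} = {0}) \<and>
         (c = d \<longrightarrow> {p. socially_optimal lam mu c d p} = {0..1}) \<and>
         (c < d \<longrightarrow> {p. socially_optimal lam mu c d p} = {1})"
proof -
  have less: "lam < mu" using assms by simp
  let ?J = "mean_idle lam mu"
  define \<phi> where "\<phi> p = (c * (lam / (mu - lam) - ?J p) + d * ?J p) / lam" for p
  have cost: "cost lam mu c d p = ennreal (\<phi> p)" if "p \<in> {0..1}" for p
    unfolding \<phi>_def using assms less that by (intro cost_eq) auto
  have anti: "?J q < ?J p" if "0 \<le> p" "p < q" "q \<le> 1" for p q
    using mean_idle_strict_antimono assms less that by blast
  have end_1: "?J 1 = 0" by (simp add: mean_idle_def)
  \<comment> \<open>The mean idle length is largest at \<open>p = 0\<close>; the bound there keeps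
    the mean busy length positive for every policy.\<close>
  have end_0: "?J 0 < lam / (mu - lam)"
  proof -
    have "lam / (mu - lam) * (lam / (mu + lam)) < lam / (mu - lam) * 1"
      using assms less by (intro mult_strict_left_mono) auto
    thus ?thesis by (simp add: mean_idle_def)
  qed
  have J_le: "?J p < lam / (mu - lam)" if "p \<in> {0..1}" for p
    using anti[of 0 p] end_0 that by (cases "p = 0") auto
  have J_ge: "0 \<le> ?J p" if "p \<in> {0..1}" for p
    using anti[of p 1] end_1 that by (cases "p = 1") auto
  \<comment> \<open>\<open>ennreal\<close> sends negative reals to 0; for positive values the order
    of the costs is that of \<open>\<phi>\<close>.\<close>
  have pos: "0 < \<phi> p" if "p \<in> {0..1}" for p
    unfolding \<phi>_def using J_le[OF that] J_ge[OF that] assms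
    by (intro divide_pos_pos add_pos_nonneg mult_pos_pos mult_nonneg_nonneg) auto
  have le_iff: "cost lam mu c d p \<le> cost lam mu c d q \<longleftrightarrow> \<phi> p \<le> \<phi> q" if "p \<in> {0..1}" "q \<in> {0..1}" for p q
    using cost that pos[OF that(2)] by (simp add: ennreal_le_iff)
  have opt: "socially_optimal lam mu c d p \<longleftrightarrow> p \<in> {0..1} \<and> (\<forall>q\<in>{0..1}. \<phi> p \<le> \<phi> q)" for p
    unfolding socially_optimal_def using le_iff by blast
  have diff: "\<phi> p - \<phi> q = (c - d) * (?J q - ?J p) / lam" for p q
    unfolding \<phi>_def diff_divide_distrib[symmetric] by (simp add: algebra_simps)
  have le_0: "?J q < ?J 0" if "q \<in> {0..1}" "q \<noteq> 0" for q using anti[of 0 q] that by auto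
  have ge_1: "?J 1 < ?J q" if "q \<in> {0..1}" "q \<noteq> 1" for q using anti[of q 1] that by auto
  show ?thesis
  proof (intro conjI impI)
    assume "c > d"
    have "\<phi> 0 < \<phi> q" if "q \<in> {0..1}" "q \<noteq> 0" for q
    proof -
      have "(c - d) * (?J q - ?J 0) / lam < 0"
        using \<open>c > d\<close> le_0[OF that] assms(1) by (intro divide_neg_pos mult_pos_neg) auto
      thus ?thesis using diff[of 0 q] by linarith
    qed
    thus "{p. socially_optimal lam mu c d p} = {0}"
      unfolding opt by (force simp: not_le[symmetric])
  next
    assume "c = d"
    hence "\<phi> p = \<phi> q" for p q using diff[of p q] by simp
    thus "{p. socially_optimal lam mu c d p} = {0..1}"
      unfolding opt by (auto intro: eq_refl)
  next
    assume "c < d"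
    have "\<phi> 1 < \<phi> q" if "q \<in> {0..1}" "q \<noteq> 1" for q
    proof -
      have "(c - d) * (?J q - ?J 1) / lam < 0"
        using \<open>c < d\<close> ge_1[OF that] assms(1) by (intro divide_neg_pos mult_neg_pos) auto
      thus ?thesis using diff[of 1 q] by linarith
    qed
    thus "{p. socially_optimal lam mu c d p} = {1}"
      unfolding opt by (force simp: not_le[symmetric])
  qed
qed

end
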